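(* Let $L_0$ be a $d$-variate stable tail dependence function and $\psi$ a $d$-Archimedean generator, and let $C$ be the Archimax copula associated with $(\psi,L_0)$. Suppose that the function $\kappa_p(w)=1-\psi(1/w)$ (equivalently, the function $\kappa_b(w)=-\log\psi(1/w)$) is regularly varying with index $-\alpha$ for some $\alpha\in(0,1]$. Suppose further that, for $j=1,\dots,d$, the $j$th first-order partial derivative $\dot L_{0,j}$ of $L_0$ exists and is continuous on $\{\boldsymbol x\in[0,\infty)^d:x_j>0\}$. If the second order regular variation condition for $\kappa_p$ (see context, $m=p$) is met with function $B_p$ and with $\rho_p'<0$, then $C$ satisfies the POT second order condition with $\alpha_p(t)=B_p(t^{1/\alpha})$ (and some $S_p$), and $\alpha_p$ is regularly varying with index $\rho_p'/\alpha$. Similarly, if the second order regular variation condition for $\kappa_b$ (see context, $m=b$) is met with function $B_b$ and with $\rho_b'<0$, then $C$ satisfies the BM second order condition with $\alpha_b(t)=B_b(t^{1/\alpha})$ (and some $S_b$), and $\alpha_b$ is regularly varying with index $\rho_b'/\alpha$.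
   Context: Operations on vectors are componentwise; $\boldsymbol 1=(1,\dots,1)$. A copula is extended to a c.d.f. on $[-\infty,\infty]^d$ in the natural way. A positive function $f$ is regularly varying with index $\rho$ (at infinity) if $\lim_{t\to\infty}f(tx)/f(t)=x^\rho$ for all $x>0$. A stable tail dependence function is a function $L:[0,\infty)^d\to[0,\infty)$ such that $\boldsymbol u\mapsto\exp\{-L(-\log u_1,\dots,-\log u_d)\}$ is an extreme-value copula, i.e. a copula $C_\infty$ with $C_\infty(\boldsymbol u^{1/s})^s=C_\infty(\boldsymbol u)$ for all $s>0$. Such $L$ is convex, homogeneous of order 1, with $L(\boldsymbol e_j)=1$ and $\max_jx_j\le L(\boldsymbol x)\le\sum_jx_j$. For completeness, at points with $x_j=0$ one sets $\dot L_{0,j}(\boldsymbol x)=\limsup_{h\downarrow0}\{L_0(\boldsymbol x+h\boldsymbol e_j)-L_0(\boldsymbol x)\}/h\in[0,1]$. $d$-Archimedean generator: a $d$-monotone function $\psi:[0,\infty)\to[0,1]$, strictly decreasing on $[0,\inf\{x\ge0:\psi(x)=0\}]$, with $\psi(0)=1$ and $\lim_{x\to\infty}\psi(x)=0$. Here $d$-monotone means that the first $d-2$ derivatives of $\psi$ exist on $(0,\infty)$ with $(-1)^j\psi^{(j)}\ge0$ for $j=0,\dots,d-2$, and $(-1)^{d-2}\psi^{(d-2)}$ is convex and non-increasing on $(0,\infty)$. $\psi^{-1}$ is the inverse of $\psi$ on $(0,1]$, and $\psi^{-1}(0)=\inf\{x\ge0:\psi(x)=0\}$. The Archimax copula associated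 with $(\psi,L_0)$ is $C(\boldsymbol u)=\psi[L_0\{\psi^{-1}(u_1),\dots,\psi^{-1}(u_d)\}]$, $\boldsymbol u\in[0,1]^d$. When $\kappa_p$ is regularly varying with index $-\alpha$, $\alpha\in(0,1]$, $C$ is in the domain of attraction of (i.e. $C(\boldsymbol u^{1/r})^r\to C_\infty(\boldsymbol u)$ as $r\to\infty$ for) the extreme-value copula $C_\infty$ with stable tail dependence function $L(\boldsymbol x)=L_0^\alpha(x_1^{1/\alpha},\dots,x_d^{1/\alpha})$. Second order regular variation condition for $\kappa_m$, $m\in\{b,p\}$: there exist a positive function $B_m$ with $\lim_{t\to\infty}B_m(t)=0$ and a function $h_{\kappa,m}$, not of the form $cx^{-\alpha}$ for some $c\in\mathbb R$, such that for all $x>0$ $$\lim_{t\to\infty}\frac1{B_m(t)}\Big\{\frac{\kappa_m(tx)}{\kappa_m(t)}-x^{-\alpha}\Big\}=h_{\kappa,m}(x).$$ In that case, necessarily $h_{\kappa,m}(x)=c_mx^{-\alpha}\frac{x^{\rho_m'}-1}{\rho_m'}$ for some constants $c_m\neq0$ and $\rho_m'\le0$ (the fraction being read as $\log x$ if $\rho_m'=0$), and $B_m$ is regularly varying with index $\rho_m'$; this defines $\rho_m'$. POT second order condition with $(\alpha_p,S_p)$: $\alpha_p:(0,\infty)\to(0,\infty)$ satisfies $\lim_{t\to\infty}\alpha_p(t)=0$, $S_p$ is a non-null (not identically zero) function on $[0,\infty)^d$, and $\lim_{t\to\infty}\frac{t\{1-C(\boldsymbol 1-\boldsymbol x/t)\}-L(\boldsymbol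 x)}{\alpha_p(t)}=S_p(\boldsymbol x)$ uniformly on $[0,T]^d$ for every fixed $T>0$. BM second order condition with $(\alpha_b,S_b)$: $\alpha_b:(0,\infty)\to(0,\infty)$ satisfies $\lim_{r\to\infty}\alpha_b(r)=0$, $S_b$ is a non-null function on $[0,1]^d$, and $\lim_{r\to\infty}\frac{C(\boldsymbol u^{1/r})^r-C_\infty(\boldsymbol u)}{\alpha_b(r)}=S_b(\boldsymbol u)$ for $\boldsymbol u\in[0,1]^d$, uniformly on $[\delta,1]^d$ for each $\delta>0$. *)

theory Defs
  imports "HOL-Probability.Probability"
begin

text \<open>
  The dimension is d = \<open>CARD('n)\<close>. The orthant \<open>[0,\<infinity>)^d\<close> is \<open>{x. 0 \<le> x}\<close> and the cube \<open>[0,1]^d\<close> is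
  \<open>{0..1}\<close>, both in the componentwise order of \<^typ>\<open>real ^ 'n\<close>; a function on one of these sets is
  a total function whose values elsewhere are irrelevant.
\<close>

definition vec_powr :: "real ^ 'n \<Rightarrow> real \<Rightarrow> real ^ 'n" where
  "vec_powr x a = (\<chi> j. x $ j powr a)"

definition is_copula :: "(real ^ 'n \<Rightarrow> real) \<Rightarrow> bool" where
  "is_copula C \<longleftrightarrow> (\<exists>M. prob_space M \<and> sets M = sets borel \<and>
     (\<forall>j. distr M borel (\<lambda>x. x $ j) = uniform_measure lborel {0..1}) \<and>
     (\<forall>u\<in>{0..1}. C u = measure M {..u}))"

definition extreme_value_copula :: "(real ^ 'n \<Rightarrow> real) \<Rightarrow> bool" where
  "extreme_value_copula C \<longleftrightarrow> is_copula C \<and>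
     (\<forall>s>0. \<forall>u\<in>{0..1}. C (vec_powr u (1 / s)) powr s = C u)"

text \<open>
  The map \<open>u \<mapsto> exp (- L (- log u))\<close>. If some coordinate of \<open>u\<close> is 0, then \<open>- log\<close> of it is \<open>\<infinity>\<close> and
  the value is \<open>exp (-\<infinity>) = 0\<close>; this needs a separate case because \<^term>\<open>ln (0::real)\<close> is 0.
\<close>

definition stdf_copula :: "(real ^ 'n \<Rightarrow> real) \<Rightarrow> real ^ 'n \<Rightarrow> real" where
  "stdf_copula L u = (if \<forall>j. 0 < u $ j then exp (- L (\<chi> j. - ln (u $ j))) else 0)"

definition stable_tail_dependence :: "(real ^ 'n \<Rightarrow> real) \<Rightarrow> bool" where
  "stable_tail_dependence L \<longleftrightarrow> (\<forall>x\<ge>0. 0 \<le> L x) \<and> extreme_value_copula (stdf_copula L)"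

definition partial_deriv :: "(real ^ 'n \<Rightarrow> real) \<Rightarrow> 'n \<Rightarrow> real ^ 'n \<Rightarrow> real" where
  "partial_deriv L j x = deriv (\<lambda>h. L (x + h *\<^sub>R axis j 1)) 0"

definition has_continuous_partials :: "(real ^ 'n \<Rightarrow> real) \<Rightarrow> bool" where
  "has_continuous_partials L \<longleftrightarrow> (\<forall>j.
     (\<forall>x\<in>{x. 0 \<le> x \<and> 0 < x $ j}. (\<lambda>h. L (x + h *\<^sub>R axis j 1)) differentiable (at 0)) \<and>
     continuous_on {x. 0 \<le> x \<and> 0 < x $ j} (partial_deriv L j))"

definition d_monotone :: "nat \<Rightarrow> (real \<Rightarrow> real) \<Rightarrow> bool" where
  "d_monotone d \<psi> \<longleftrightarrow>
     (\<forall>j<d - 2. \<forall>x>0. (deriv ^^ j) \<psi> differentiable (at x)) \<and>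
     (\<forall>j\<le>d - 2. \<forall>x>0. 0 \<le> (- 1) ^ j * (deriv ^^ j) \<psi> x) \<and>
     convex_on {0<..} (\<lambda>x. (- 1) ^ (d - 2) * (deriv ^^ (d - 2)) \<psi> x) \<and>
     antimono_on {0<..} (\<lambda>x. (- 1) ^ (d - 2) * (deriv ^^ (d - 2)) \<psi> x)"

text \<open>\<open>inf {x \<ge> 0. \<psi> x = 0}\<close>, which is \<open>\<infinity>\<close> if \<open>\<psi>\<close> has no zero.\<close>

definition gen_zero :: "(real \<Rightarrow> real) \<Rightarrow> ereal" where
  "gen_zero \<psi> = Inf (ereal ` {x. 0 \<le> x \<and> \<psi> x = 0})"

definition archimedean_generator :: "nat \<Rightarrow> (real \<Rightarrow> real) \<Rightarrow> bool" where
  "archimedean_generator d \<psi> \<longleftrightarrow>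
     (\<forall>x\<ge>0. \<psi> x \<in> {0..1}) \<and> d_monotone d \<psi> \<and>
     strict_antimono_on {x. 0 \<le> x \<and> ereal x \<le> gen_zero \<psi>} \<psi> \<and>
     \<psi> 0 = 1 \<and> (\<psi> \<longlongrightarrow> 0) at_top"

definition gen_inv :: "(real \<Rightarrow> real) \<Rightarrow> real \<Rightarrow> ereal" where
  "gen_inv \<psi> u = (if u = 0 then gen_zero \<psi> else ereal (THE x. 0 \<le> x \<and> \<psi> x = u))"

text \<open>
  If some \<open>\<psi>\<^sup>-\<^sup>1(u\<^sub>j)\<close> is \<open>\<infinity>\<close> (so \<open>u\<^sub>j = 0\<close>), then \<open>L\<close>, being at least the maximum of its arguments, is \<open>\<infinity>\<close>
  there, and \<open>\<psi>(\<infinity>) = lim \<psi> = 0\<close>.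
\<close>

definition archimax :: "(real \<Rightarrow> real) \<Rightarrow> (real ^ 'n \<Rightarrow> real) \<Rightarrow> real ^ 'n \<Rightarrow> real" where
  "archimax \<psi> L u =
     (if \<exists>j. gen_inv \<psi> (u $ j) = \<infinity> then 0
      else \<psi> (L (\<chi> j. real_of_ereal (gen_inv \<psi> (u $ j)))))"

definition kappa_p :: "(real \<Rightarrow> real) \<Rightarrow> real \<Rightarrow> real" where
  "kappa_p \<psi> w = 1 - \<psi> (1 / w)"

text \<open>
  Where \<open>\<psi> (1 / w) = 0\<close> the mathematical value is \<open>\<infinity>\<close>, not the 0 given here; since \<open>\<psi> (1 / w) > 0\<close> for
  all large \<open>w\<close>, this does not affect limits at infinity.
\<close>

definition kappa_b :: "(real \<Rightarrow> real) \<Rightarrow> real \<Rightarrow> real" where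
  "kappa_b \<psi> w = - ln (\<psi> (1 / w))"

definition regularly_varying :: "(real \<Rightarrow> real) \<Rightarrow> real \<Rightarrow> bool" where
  "regularly_varying f \<rho> \<longleftrightarrow> (\<forall>t>0. 0 < f t) \<and>
     (\<forall>x>0. ((\<lambda>t. f (t * x) / f t) \<longlongrightarrow> x powr \<rho>) at_top)"

definition second_order_rv ::
    "(real \<Rightarrow> real) \<Rightarrow> real \<Rightarrow> (real \<Rightarrow> real) \<Rightarrow> (real \<Rightarrow> real) \<Rightarrow> bool" where
  "second_order_rv \<kappa> \<alpha> B h \<longleftrightarrow>
     (\<forall>t>0. 0 < B t) \<and> (B \<longlongrightarrow> 0) at_top \<and>
     \<not> (\<exists>c. \<forall>x>0. h x = c * x powr (- \<alpha>)) \<and>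
     (\<forall>x>0. ((\<lambda>t. (\<kappa> (t * x) / \<kappa> t - x powr (- \<alpha>)) / B t) \<longlongrightarrow> h x) at_top)"

text \<open>
  The second order parameter \<open>\<rho>'\<close>. A limit \<open>h\<close> in \<^const>\<open>second_order_rv\<close> necessarily has the
  following form, and \<open>\<rho>'\<close> is uniquely determined by it.
\<close>

definition second_order_param :: "real \<Rightarrow> (real \<Rightarrow> real) \<Rightarrow> real \<Rightarrow> bool" where
  "second_order_param \<alpha> h \<rho> \<longleftrightarrow> \<rho> \<le> 0 \<and>
     (\<exists>c. c \<noteq> 0 \<and> (\<forall>x>0. h x =
        c * x powr (- \<alpha>) * (if \<rho> = 0 then ln x else (x powr \<rho> - 1) / \<rho>)))"

text \<open>
  No extension of \<open>C\<close> beyond the cube is needed: for \<open>x \<in> [0,T]^d\<close> and \<open>t \<ge> T\<close> the point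
  \<open>1 - x / t\<close> lies in \<open>[0,1]^d\<close>.
\<close>

definition POT_second_order ::
    "(real ^ 'n \<Rightarrow> real) \<Rightarrow> (real ^ 'n \<Rightarrow> real) \<Rightarrow> (real \<Rightarrow> real) \<Rightarrow> (real ^ 'n \<Rightarrow> real) \<Rightarrow> bool" where
  "POT_second_order C L a S \<longleftrightarrow>
     (\<forall>t>0. 0 < a t) \<and> (a \<longlongrightarrow> 0) at_top \<and> (\<exists>x\<ge>0. S x \<noteq> 0) \<and>
     (\<forall>T>0. uniform_limit {0..vec T}
        (\<lambda>t x. (t * (1 - C (1 - x /\<^sub>R t)) - L x) / a t) S at_top)"

definition BM_second_order ::
    "(real ^ 'n \<Rightarrow> real) \<Rightarrow> (real ^ 'n \<Rightarrow> real) \<Rightarrow> (real \<Rightarrow> real) \<Rightarrow> (real ^ 'n \<Rightarrow> real) \<Rightarrow> bool" where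
  "BM_second_order C K a S \<longleftrightarrow>
     (\<forall>r>0. 0 < a r) \<and> (a \<longlongrightarrow> 0) at_top \<and> (\<exists>u\<in>{0..1}. S u \<noteq> 0) \<and>
     (\<forall>u\<in>{0..1}.
        ((\<lambda>r. (C (vec_powr u (1 / r)) powr r - K u) / a r) \<longlongrightarrow> S u) at_top) \<and>
     (\<forall>\<delta>>0. uniform_limit {vec \<delta>..1}
        (\<lambda>r u. (C (vec_powr u (1 / r)) powr r - K u) / a r) S at_top)"

definition attractor_stdf :: "(real ^ 'n \<Rightarrow> real) \<Rightarrow> real \<Rightarrow> real ^ 'n \<Rightarrow> real" where
  "attractor_stdf L \<alpha> x = L (vec_powr x (1 / \<alpha>)) powr \<alpha>"

end

theory Submission
  imports Defs
begin

text \<open>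
  Write \<open>N\<close> for \<open>1 - \<psi>\<close> in the case of threshold exceedances and for \<open>- ln \<psi>\<close> in the case of
  block maxima, and \<open>\<kappa> w = N (1 / w)\<close>. In both cases the quantity to be expanded is \<open>t * N
  (L0 \<zeta>)\<close>, where the vector \<open>\<zeta>\<close> of inverse generators is determined by \<open>t * N \<zeta>\<^sub>j = x\<^sub>j\<close>;
  for block maxima the result is finally inserted into the exponential function.

  Put \<open>s = t powr (1 / \<alpha>)\<close>. Because \<open>\<rho> < 0\<close>, the tail function has the form \<open>\<kappa> w = c * w
  powr (- \<alpha>) * (1 + D w)\<close> with \<open>D\<close> asymptotic to a multiple of \<open>B\<close>. Hence, locally uniformly
  in \<open>z \<ge> 0\<close>, \<open>t * N (z / s) = c * z powr \<alpha> + B s * (R z + o(1))\<close> with \<open>R z = K * z powr (\<alpha>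
  - \<rho>)\<close> (\<open>second_order_expansion\<close>). The rate \<open>B\<close> comes without any regularity, but \<open>D\<close> is
  continuous, so the local uniformity follows from the uniform convergence theorem for
  regularly varying functions (\<open>regularly_varying_sequentially\<close>), which rests on Baire's
  theorem.

  For \<open>z = s * \<zeta>\<close> the defining equations read \<open>c * z\<^sub>j powr \<alpha> = x\<^sub>j - B s * R z\<^sub>j\<close> up to
  terms of smaller order. With the attractor \<open>L\<close>, homogeneity of \<open>L0\<close> turns the leading term
  \<open>c * L0 z powr \<alpha>\<close> into \<open>L (x - B s * R z)\<close>, so that \<open>t * N (L0 \<zeta>) = L (x - B s * R z) + B
  s * R (L0 z)\<close>, again up to smaller terms. A first order expansion of \<open>L\<close>
  (\<open>orthant_difference_quotient\<close>) gives the limit \<open>R (L0 z) - (\<Sum>j. L'\<^sub>j x * R z\<^sub>j)\<close> at \<open>z\<^sub>j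
  = (x\<^sub>j / c) powr (1 / \<alpha>)\<close> (\<open>archimax_expansion\<close>). On the boundary of the orthant \<open>L\<close> may
  fail to be differentiable, but there \<open>R z\<^sub>j\<close> vanishes and \<open>L\<close> is Lipschitz. Uniformity on
  compact sets is obtained by letting \<open>t\<close> and \<open>x\<close> vary together along sequences
  (\<open>uniform_limit_compactI\<close>).

  The limit is not null: by Euler's identity its value at \<open>1\<close> is a nonzero multiple of \<open>a
  powr (1 - \<rho> / \<alpha>) - a\<close> with \<open>a = L 1\<close>, and \<open>a > 1\<close> because a smooth \<open>L\<close> cannot be the
  maximum of its arguments at \<open>1\<close> (\<open>attractor_one_gt_one\<close>).
\<close>

section \<open>Locally uniform convergence in regular variation\<close>

text \<open>
  A pointwise limit under translation is automatically uniform for small shifts. The closed sets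
  \<open>V n\<close> of shifts for which the increment is at most \<open>e / 2\<close> beyond \<open>u0 + n\<close> exhaust the line, so by
  Baire's theorem one of them contains an interval; subtracting the increment at its left end point
  moves this interval to the origin at the price of a factor 2.
\<close>

lemma translation_limit_locally_uniform:
  fixes k :: "real \<Rightarrow> real"
  assumes cont: "continuous_on {u0..} k"
    and lim: "\<And>v. ((\<lambda>u. k (u + v) - k u) \<longlongrightarrow> 0) at_top"
    and e: "0 < e"
  shows "\<exists>\<delta>>0. \<exists>T. \<forall>u\<ge>T. \<forall>z\<in>{0..\<delta>}. \<bar>k (u + z) - k u\<bar> \<le> e"
proof -
  define V where "V n = {y. \<forall>u\<in>{u0 + real n..}. \<bar>k (u + \<bar>y\<bar>) - k u\<bar> \<le> e / 2}" for n :: nat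
  have cl: "closed (V n)" for n
  proof -
    have "closed {y. \<bar>k (u + \<bar>y\<bar>) - k u\<bar> \<le> e / 2}" if "u \<in> {u0 + real n..}" for u
    proof -
      have "continuous_on UNIV (\<lambda>y. k (u + \<bar>y\<bar>))"
        by (rule continuous_on_compose2[OF cont]) (use that in \<open>auto intro!: continuous_intros\<close>)
      then show ?thesis
        by (intro closed_Collect_le continuous_intros)
    qed
    then have "closed (\<Inter>u\<in>{u0 + real n..}. {y. \<bar>k (u + \<bar>y\<bar>) - k u\<bar> \<le> e / 2})"
      by blast
    also have "(\<Inter>u\<in>{u0 + real n..}. {y. \<bar>k (u + \<bar>y\<bar>) - k u\<bar> \<le> e / 2}) = V n"
      by (auto simp: V_def)
    finally show ?thesis .
  qed
  have cover: "\<exists>n. y \<in> V n" for y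
  proof -
    have "\<forall>\<^sub>F u in at_top. \<bar>k (u + \<bar>y\<bar>) - k u\<bar> < e / 2"
      using tendstoD[OF lim[of "\<bar>y\<bar>"], of "e/2"] e by (simp add: dist_real_def)
    then obtain T where T: "\<And>u. u \<ge> T \<Longrightarrow> \<bar>k (u + \<bar>y\<bar>) - k u\<bar> < e / 2"
      by (auto simp: eventually_at_top_linorder)
    obtain n :: nat where "T - u0 \<le> real n"
      using real_arch_simple by blast
    then have "\<bar>k (u + \<bar>y\<bar>) - k u\<bar> \<le> e / 2" if "u \<ge> u0 + real n" for u
      using T[of u] that by linarith
    then show ?thesis by (auto simp: V_def)
  qed
  have "\<exists>n. interior (V n) \<noteq> {}"
  proof (rule ccontr)
    assume a: "\<not> ?thesis"
    have "(UNIV :: real set) \<subseteq> closure (\<Inter>(range (\<lambda>n. - V n)))"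
    proof (rule Baire)
      fix T assume "T \<in> range (\<lambda>n. - V n)"
      then obtain n where n: "T = - V n" by auto
      have "closure (- V n) = UNIV"
        using a by (simp add: closure_complement)
      then show "openin (top_of_set UNIV) T \<and> UNIV \<subseteq> closure T"
        using cl[of n] n by (simp add: open_Compl)
    qed auto
    moreover have "\<Inter>(range (\<lambda>n. - V n)) = {}"
      using cover by auto
    ultimately show False by simp
  qed
  then obtain n a where "a \<in> interior (V n)" by blast
  then obtain d where d: "0 < d" "ball a d \<subseteq> V n"
    by (auto simp: mem_interior)
  \<comment> \<open>\<open>|y|\<close> covers an interval to the right of \<open>|a|\<close> as \<open>y\<close> ranges over the ball around \<open>a\<close>\<close>
  have key: "\<bar>k (u + (\<bar>a\<bar> + z)) - k u\<bar> \<le> e / 2" if "u \<ge> u0 + real n" "0 \<le> z" "z \<le> d / 2" for u z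
  proof -
    define y where "y = (if a \<ge> 0 then a + z else a - z)"
    have "y \<in> ball a d"
      using that d by (auto simp: y_def dist_real_def)
    then have "y \<in> V n" using d by blast
    moreover have "\<bar>y\<bar> = \<bar>a\<bar> + z"
      using that by (auto simp: y_def)
    ultimately show ?thesis
      using that by (auto simp: V_def)
  qed
  have "\<bar>k (u + z) - k u\<bar> \<le> e" if "u \<ge> u0 + real n + \<bar>a\<bar>" "z \<in> {0..d/2}" for u z
    using key[of "u - \<bar>a\<bar>" z] key[of "u - \<bar>a\<bar>" 0] that d by (simp add: algebra_simps) argo
  then show ?thesis
    using d by (intro exI[of _ "d / 2"] conjI exI[of _ "u0 + real n + \<bar>a\<bar>"]) auto
qed

text \<open>
  The increment over \<open>v n\<close> differs from the one over \<open>v0\<close> by an increment over a small shift, which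
  the preceding lemma controls.
\<close>

lemma translation_limit_sequentially:
  fixes k :: "real \<Rightarrow> real"
  assumes cont: "continuous_on {u0..} k"
    and lim: "\<And>v. ((\<lambda>u. k (u + v) - k u) \<longlongrightarrow> 0) at_top"
    and u: "filterlim u at_top sequentially" and v: "v \<longlonglongrightarrow> v0"
  shows "(\<lambda>n. k (u n + v n) - k (u n)) \<longlonglongrightarrow> 0"
proof (rule tendstoI)
  fix e :: real assume e: "0 < e"
  have "\<exists>\<delta>>0. \<exists>T. \<forall>u\<ge>T. \<forall>z\<in>{0..\<delta>}. \<bar>k (u + z) - k u\<bar> \<le> e / 3"
    by (rule translation_limit_locally_uniform[OF cont lim]) (use e in simp)
  then obtain d T where d: "0 < d" and T: "\<And>u z. u \<ge> T \<Longrightarrow> z \<in> {0..d} \<Longrightarrow> \<bar>k (u + z) - k u\<bar> \<le> e / 3"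
    by blast
  have "(\<lambda>n. k (u n + v0) - k (u n)) \<longlonglongrightarrow> 0"
    by (rule filterlim_compose[OF lim u])
  then have "\<forall>\<^sub>F n in sequentially. \<bar>k (u n + v0) - k (u n)\<bar> < e / 3"
    using tendstoD[of _ _ _ "e/3"] e by (fastforce simp: dist_real_def)
  moreover have "\<forall>\<^sub>F n in sequentially. \<bar>v n - v0\<bar> < d"
    using tendstoD[OF v d] by (simp add: dist_real_def)
  moreover have "\<forall>\<^sub>F n in sequentially. u n \<ge> T - v0 + d"
    using u by (auto simp: filterlim_at_top)
  ultimately show "\<forall>\<^sub>F n in sequentially. dist (k (u n + v n) - k (u n)) 0 < e"
  proof eventually_elim
    case (elim n)
    have "\<bar>k (u n + v n) - k (u n + v0)\<bar> \<le> e / 3"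
    proof (cases "v n \<ge> v0")
      case True
      then show ?thesis using T[of "u n + v0" "v n - v0"] elim d by auto
    next
      case False
      then show ?thesis using T[of "u n + v n" "v0 - v n"] elim d by (simp add: abs_minus_commute)
    qed
    then show ?case using elim unfolding dist_real_def by linarith
  qed
qed

text \<open>
  The uniform convergence theorem for regularly varying functions, in the sequential form used below.
  It is the additive statement for \<open>u \<mapsto> ln \<bar>f (exp u)\<bar> - \<rho> * u\<close>; a continuous function without zeros
  has a constant sign, so the absolute value loses nothing.
\<close>

lemma regularly_varying_sequentially:
  fixes f :: "real \<Rightarrow> real"
  assumes cont: "continuous_on {w0..} f" and nz: "\<And>w. w \<ge> w0 \<Longrightarrow> f w \<noteq> 0"
    and lim: "\<And>x. 0 < x \<Longrightarrow> ((\<lambda>t. f (t * x) / f t) \<longlongrightarrow> x powr \<rho>) at_top"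
    and t: "filterlim t at_top sequentially" and x: "x \<longlonglongrightarrow> x0" and x0: "0 < x0"
  shows "(\<lambda>n. f (t n * x n) / f (t n)) \<longlonglongrightarrow> x0 powr \<rho>"
proof -
  define k where "k u = ln \<bar>f (exp u)\<bar> - \<rho> * u" for u
  \<comment> \<open>at least 1, so that \<open>ln w1\<close> is meaningful whatever \<open>w0\<close> is\<close>
  define w1 where "w1 = max 1 w0"
  have nz': "f w \<noteq> 0" if "w \<ge> w1" for w using nz that by (auto simp: w1_def)
  have ge: "w1 \<le> exp u" if "u \<ge> ln w1" for u
    using that by (metis exp_le_cancel_iff exp_ln max.cobounded1 order_less_le_trans w1_def zero_less_one)
  have sgn: "0 < f (t * x) / f t" if "t \<ge> w1" "t * x \<ge> w1" for t x
  proof -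
    have c: "continuous_on {w1..} f" by (rule continuous_on_subset[OF cont]) (auto simp: w1_def)
    have "connected (f ` {w1..})" by (rule connected_continuous_image[OF c]) simp
    moreover have "0 \<notin> f ` {w1..}" using nz' by (metis atLeast_iff imageE)
    ultimately have "(f t < 0 \<longleftrightarrow> f (t * x) < 0)"
      using that connectedD_interval[of "f ` {w1..}" "f t" "f (t*x)" 0]
        connectedD_interval[of "f ` {w1..}" "f (t*x)" "f t" 0] nz'[of t] nz'[of "t*x"]
      by (metis atLeast_iff imageI linorder_not_le not_less_iff_gr_or_eq order_le_less)
    then show ?thesis using nz'[OF that(1)] nz'[OF that(2)]
      by (metis divide_neg_neg divide_pos_pos linorder_neqE_linordered_idom)
  qed
  have kd: "exp (k (u + v) - k u) = f (exp u * exp v) / f (exp u) * exp v powr (-\<rho>)"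
    if "u \<ge> ln w1" "u + v \<ge> ln w1" for u v
  proof -
    have p: "0 < f (exp u * exp v) / f (exp u)"
      using sgn[of "exp u" "exp v"] ge[OF that(1)] ge[OF that(2)] by (simp add: exp_add)
    have "k (u + v) - k u = (ln \<bar>f (exp u * exp v)\<bar> - ln \<bar>f (exp u)\<bar>) - \<rho> * v"
      by (simp add: k_def exp_add algebra_simps)
    also have "ln \<bar>f (exp u * exp v)\<bar> - ln \<bar>f (exp u)\<bar> = ln \<bar>f (exp u * exp v) / f (exp u)\<bar>"
      using p by (auto simp: abs_divide ln_div)
    finally show ?thesis
      using p by (simp add: exp_diff powr_def exp_minus divide_inverse)
  qed
  have lim0: "((\<lambda>u. k (u + v) - k u) \<longlongrightarrow> 0) at_top" for v
  proof -
    have "((\<lambda>u. f (exp u * exp v) / f (exp u) * exp v powr (-\<rho>)) \<longlongrightarrow> exp v powr \<rho> * exp v powr (-\<rho>)) at_top"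
      by (intro tendsto_intros filterlim_compose[OF lim exp_at_top]) auto
    moreover have "exp v powr \<rho> * exp v powr (-\<rho>) = 1" by (simp add: powr_minus)
    moreover have "\<forall>\<^sub>F u in at_top. f (exp u * exp v) / f (exp u) * exp v powr (-\<rho>) = exp (k (u + v) - k u)"
      using eventually_ge_at_top[of "ln w1"] eventually_ge_at_top[of "ln w1 - v"]
      by eventually_elim (simp add: kd)
    ultimately have "((\<lambda>u. exp (k (u + v) - k u)) \<longlongrightarrow> 1) at_top"
      using Lim_transform_eventually by force
    then have "((\<lambda>u. ln (exp (k (u + v) - k u))) \<longlongrightarrow> ln 1) at_top"
      by (rule tendsto_ln) simp
    then show ?thesis by simp
  qed
  have kc: "continuous_on {ln w1..} k"
    unfolding k_def
    by (intro continuous_intros continuous_on_compose2[OF cont])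
      (use ge nz' in \<open>auto simp: w1_def\<close>)
  have tpos: "\<forall>\<^sub>F n in sequentially. t n > 0"
    using t by (auto simp: filterlim_at_top_dense)
  have xpos: "\<forall>\<^sub>F n in sequentially. x n > 0"
    using order_tendstoD(1)[OF x x0] .
  have lt: "filterlim (\<lambda>n. ln (t n)) at_top sequentially"
    by (rule filterlim_compose[OF ln_at_top t])
  have lx: "(\<lambda>n. ln (x n)) \<longlonglongrightarrow> ln x0" using x x0 by (intro tendsto_ln) auto
  have "(\<lambda>n. exp (k (ln (t n) + ln (x n)) - k (ln (t n))) * x n powr \<rho>) \<longlonglongrightarrow> exp 0 * x0 powr \<rho>"
    using x0 by (intro tendsto_intros translation_limit_sequentially[OF kc lim0 lt lx] x) auto
  moreover have "\<forall>\<^sub>F n in sequentially. exp (k (ln (t n) + ln (x n)) - k (ln (t n))) * x n powr \<rho>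
      = f (t n * x n) / f (t n)"
  proof -
    have "filterlim (\<lambda>n. ln (x n) + ln (t n)) at_top sequentially"
      by (rule filterlim_tendsto_add_at_top[OF lx lt])
    then have "\<forall>\<^sub>F n in sequentially. ln (x n) + ln (t n) \<ge> ln w1"
      by (auto simp: filterlim_at_top)
    moreover have "\<forall>\<^sub>F n in sequentially. ln (t n) \<ge> ln w1"
      using lt by (auto simp: filterlim_at_top)
    ultimately show ?thesis using tpos xpos
      by eventually_elim (simp add: kd add.commute powr_minus)
  qed
  ultimately show ?thesis
    using Lim_transform_eventually by force
qed

section \<open>Second order regular variation with a negative parameter\<close>

text \<open>
  The difference quotient of \<open>f\<close> at 0 along increments \<open>a t * b t\<close> that need not be nonzero: \<open>a\<close> may
  vanish, only the scale \<open>b\<close> may not. It transfers first order terms on the scale \<open>b\<close> through \<open>ln\<close> and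
  \<open>exp\<close>.
\<close>

lemma tendsto_secant:
  fixes f :: "real \<Rightarrow> real"
  assumes f: "(f has_real_derivative D) (at 0)" and f0: "f 0 = 0"
    and b: "(b \<longlongrightarrow> 0) F" and a: "(a \<longlongrightarrow> a0) F" and nz: "\<forall>\<^sub>F t in F. b t \<noteq> 0"
  shows "((\<lambda>t. f (a t * b t) / b t) \<longlongrightarrow> D * a0) F"
proof -
  define q where "q y = (if y = 0 then D else f y / y)" for y
  have "isCont q 0"
    unfolding isCont_def
  proof (rule Lim_transform_eventually)
    show "(\<lambda>y. f y / y) \<midarrow>0\<rightarrow> q 0"
      using f f0 by (simp add: has_field_derivative_iff q_def)
    show "\<forall>\<^sub>F y in at 0. f y / y = q y"
      by (auto simp: eventually_at_filter q_def)
  qed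
  moreover have "((\<lambda>t. a t * b t) \<longlongrightarrow> 0) F"
    using tendsto_mult[OF a b] by simp
  ultimately have "((\<lambda>t. q (a t * b t)) \<longlongrightarrow> q 0) F"
    by (rule isCont_tendsto_compose)
  from tendsto_mult[OF this a] have "((\<lambda>t. q (a t * b t) * a t) \<longlongrightarrow> D * a0) F"
    by (simp add: q_def)
  moreover have "\<forall>\<^sub>F t in F. q (a t * b t) * a t = f (a t * b t) / b t"
    using nz by eventually_elim (auto simp: q_def f0)
  ultimately show ?thesis
    by (rule Lim_transform_eventually)
qed

text \<open>
  The second order condition with \<open>\<rho> < 0\<close>, for a tail function that is positive and continuous from
  \<open>w0\<close> on. The rate \<open>B\<close> itself is an arbitrary positive function, possibly not even measurable, so
  locally uniform statements have to be derived for expressions in \<open>\<kappa>\<close> and then compared with \<open>B\<close>.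
\<close>

locale second_order_tail =
  fixes \<kappa> B :: "real \<Rightarrow> real" and \<alpha> \<rho> \<gamma> w0 :: real
  assumes alpha: "0 < \<alpha>" and rho: "\<rho> < 0" and gamma: "\<gamma> \<noteq> 0" and w0: "0 < w0"
    and kappa_pos: "\<And>w. w0 \<le> w \<Longrightarrow> 0 < \<kappa> w" and kappa_cont: "continuous_on {w0..} \<kappa>"
    and B_pos: "\<And>t. 0 < t \<Longrightarrow> 0 < B t" and B_lim: "(B \<longlongrightarrow> 0) at_top"
    and kappa_lim: "\<And>x. 0 < x \<Longrightarrow> ((\<lambda>t. (\<kappa> (t * x) / \<kappa> t - x powr (- \<alpha>)) / B t)
          \<longlongrightarrow> \<gamma> * x powr (- \<alpha>) * ((x powr \<rho> - 1) / \<rho>)) at_top"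
begin

definition slow_part :: "real \<Rightarrow> real" where "slow_part w = w powr \<alpha> * \<kappa> w"

lemma slow_part_pos: "w0 \<le> w \<Longrightarrow> 0 < slow_part w"
  using w0 kappa_pos by (simp add: slow_part_def)

lemma B_ev_nz: "\<forall>\<^sub>F t in at_top. B t \<noteq> 0"
  using eventually_gt_at_top[of 0] by eventually_elim (use B_pos in \<open>auto simp: less_le\<close>)

lemma scale_at_top: "0 < x \<Longrightarrow> filterlim (\<lambda>t. t * x) at_top at_top" for x :: real
  using filterlim_tendsto_pos_mult_at_top[OF tendsto_const, of x "\<lambda>t. t" at_top]
  by (simp add: filterlim_ident mult.commute)

lemma slow_part_second_order:
  assumes x: "0 < x"
  shows "((\<lambda>t. (slow_part (t * x) / slow_part t - 1) / B t) \<longlongrightarrow> \<gamma> * (x powr \<rho> - 1) / \<rho>) at_top"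
proof -
  have "((\<lambda>t. x powr \<alpha> * ((\<kappa> (t * x) / \<kappa> t - x powr (- \<alpha>)) / B t))
      \<longlongrightarrow> x powr \<alpha> * (\<gamma> * x powr (- \<alpha>) * ((x powr \<rho> - 1) / \<rho>))) at_top"
    by (intro tendsto_mult kappa_lim x tendsto_const)
  moreover have "x powr \<alpha> * (\<gamma> * x powr (- \<alpha>) * ((x powr \<rho> - 1) / \<rho>)) = \<gamma> * (x powr \<rho> - 1) / \<rho>"
    using x by (simp add: powr_minus)
  moreover have "\<forall>\<^sub>F t in at_top. x powr \<alpha> * ((\<kappa> (t * x) / \<kappa> t - x powr (- \<alpha>)) / B t)
      = (slow_part (t * x) / slow_part t - 1) / B t"
    using eventually_ge_at_top[of w0]
  proof eventually_elim
    case (elim t)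
    then have "\<kappa> t > 0" "t > 0" using kappa_pos w0 by auto
    then show ?case using x by (simp add: slow_part_def powr_mult powr_minus divide_simps)
  qed
  ultimately show ?thesis
    by (rule Lim_transform_eventually[OF tendsto_eq_rhs])
qed

lemma slow_part_ratio:
  assumes x: "0 < x"
  shows "((\<lambda>t. slow_part (t * x) / slow_part t) \<longlongrightarrow> 1) at_top"
proof -
  have "((\<lambda>t. 1 + ((slow_part (t * x) / slow_part t - 1) / B t) * B t) \<longlongrightarrow> 1 + (\<gamma> * (x powr \<rho>
      - 1) / \<rho>) * 0) at_top"
    by (intro tendsto_intros slow_part_second_order x B_lim)
  moreover have "\<forall>\<^sub>F t in at_top. 1 + ((slow_part (t * x) / slow_part t - 1) / B t) * B t
      = slow_part (t * x) / slow_part t"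
    using B_ev_nz by eventually_elim simp
  ultimately show ?thesis
    by (rule Lim_transform_eventually[THEN tendsto_eq_rhs]) simp
qed

text \<open>
  Going from \<open>t\<close> to \<open>2 * x * t\<close> directly, or through \<open>x * t\<close>, gives two expressions for the same ratio.
  Equating their second order terms yields \<open>B (t * x) / B t\<close>, provided that the second order limit at the
  factor 2 does not vanish.
\<close>

lemma B_regularly_varying:
  assumes x: "0 < x"
  shows "((\<lambda>t. B (t * x) / B t) \<longlongrightarrow> x powr \<rho>) at_top"
proof -
  define A where "A t y = (slow_part (t * y) / slow_part t - 1) / B t" for t y
  define k where "k y = \<gamma> * (y powr \<rho> - 1) / \<rho>" for y
  have A: "((\<lambda>t. A t y) \<longlongrightarrow> k y) at_top" if "0 < y" for y
    unfolding A_def k_def by (rule slow_part_second_order[OF that])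
  have two: "(2::real) powr \<rho> < 1" using rho by (simp add: powr_less_one)
  then have k2: "k 2 \<noteq> 0" using gamma rho by (auto simp: k_def)
  have Ax: "((\<lambda>t. A (t * x) 2) \<longlongrightarrow> k 2) at_top"
    by (rule filterlim_compose[OF A scale_at_top[OF x]]) simp
  have "((\<lambda>t. (A t (x * 2) - A t x) / (A (t * x) 2 * (1 + A t x * B t))) \<longlongrightarrow> (k (x * 2)
      - k x) / (k 2 * (1 + k x * 0))) at_top"
    by (intro tendsto_intros Ax A x B_lim) (use k2 x in auto)
  moreover have "(k (x * 2) - k x) / (k 2 * (1 + k x * 0)) = x powr \<rho>"
    using k2 two gamma rho x by (simp add: k_def powr_mult divide_simps) (simp add: algebra_simps)
  moreover have "\<forall>\<^sub>F t in at_top. (A t (x * 2) - A t x) / (A (t * x) 2 * (1 + A t x * B t))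
      = B (t * x) / B t"
  proof -
    have "\<forall>\<^sub>F t in at_top. t * x > w0"
      using scale_at_top[OF x] by (auto simp: filterlim_at_top_dense)
    moreover have "\<forall>\<^sub>F t in at_top. A (t * x) 2 \<noteq> 0"
      by (rule tendsto_imp_eventually_ne[OF Ax k2])
    ultimately show ?thesis
      using eventually_ge_at_top[of w0]
    proof eventually_elim
      case (elim t)
      have p: "slow_part t > 0" "slow_part (t * x) > 0" "B t > 0" "B (t * x) > 0"
          using elim slow_part_pos B_pos w0 by auto
      have e1: "1 + A t x * B t = slow_part (t * x) / slow_part t" using p by (simp add: A_def)
      have e2: "A (t * x) 2 * B (t * x) = slow_part (t * (x * 2)) / slow_part (t * x) - 1"
        using p by (simp add: A_def mult.assoc)
      have e3: "A t (x * 2) * B t = slow_part (t * (x * 2)) / slow_part t - 1" "A t x * B t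
          = slow_part (t * x) / slow_part t - 1" using p by (simp_all add: A_def)
      have "(A t (x * 2) - A t x) * B t = (A (t * x) 2 * B (t * x)) * (1 + A t x * B t)"
        unfolding e1 e2 left_diff_distrib e3 using p by (simp add: field_simps)
      moreover have "1 + A t x * B t \<noteq> 0" using e1 p by simp
      ultimately show ?case using elim p by (simp add: divide_simps)
    qed
  qed
  ultimately show ?thesis
    by (rule Lim_transform_eventually[OF tendsto_eq_rhs])
qed

text \<open>
  The heart of the case \<open>\<rho> < 0\<close>: \<open>\<kappa> w\<close> is asymptotic to \<open>c * w powr (- \<alpha>)\<close>, and the relative error
  is asymptotic to a multiple of \<open>B\<close>. The increments \<open>e t\<close> of \<open>ln slow_part\<close> over a doubling of the
  argument are of order \<open>B t\<close>, hence regularly varying with index \<open>\<rho>\<close>, and decay geometrically along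
  \<open>t * 2 ^ n\<close>. So \<open>ln slow_part\<close> converges, and the distance to its limit is the sum of the increments,
  which Tannery's theorem evaluates as \<open>e t / (1 - 2 powr \<rho>)\<close> to first order.
\<close>

lemma slow_part_limit:
  obtains c where "0 < c" "((\<lambda>t. (slow_part t / c - 1) / B t) \<longlongrightarrow> \<gamma> / \<rho>) at_top"
proof -
  define e where "e t = ln (slow_part (t * 2)) - ln (slow_part t)" for t
  define q :: real where "q = 2 powr \<rho>"
  define k where "k = \<gamma> * (q - 1) / \<rho>"
  have q: "0 < q" "q < 1" using rho by (auto simp: q_def powr_less_one)
  have k: "k \<noteq> 0" using gamma rho q by (auto simp: k_def)
  have eB: "((\<lambda>t. e t / B t) \<longlongrightarrow> k) at_top"
  proof -
    have "((\<lambda>t. ln (1 + (slow_part (t * 2) / slow_part t - 1) / B t * B t) / B t) \<longlongrightarrow> 1 * k) at_top"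
      unfolding k_def q_def
      by (rule tendsto_secant[OF _ _ B_lim slow_part_second_order B_ev_nz])
        (auto intro!: derivative_eq_intros)
    moreover have "\<forall>\<^sub>F t in at_top. ln (1 + (slow_part (t * 2) / slow_part t - 1) / B t * B t) / B t
        = e t / B t"
      using eventually_ge_at_top[of w0] eventually_gt_at_top[of 0]
    proof eventually_elim
      case (elim t)
      then have "slow_part t > 0" "slow_part (t * 2) > 0" "B t > 0" using slow_part_pos B_pos by auto
      then show ?case by (simp add: e_def ln_div)
    qed
    ultimately show ?thesis by (rule Lim_transform_eventually[THEN tendsto_eq_rhs]) simp
  qed
  have e_nz: "\<forall>\<^sub>F t in at_top. e t \<noteq> 0"
    using tendsto_imp_eventually_ne[OF eB k] by eventually_elim auto
  have e_rv: "((\<lambda>t. e (t * x) / e t) \<longlongrightarrow> x powr \<rho>) at_top" if x: "0 < x" for x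
  proof -
    have "((\<lambda>t. (e (t * x) / B (t * x)) / (e t / B t) * (B (t * x) / B t)) \<longlongrightarrow> k / k * x powr \<rho>) at_top"
      by (intro tendsto_intros B_regularly_varying x eB k filterlim_compose[OF eB scale_at_top[OF x]])
    moreover have "\<forall>\<^sub>F t in at_top. (e (t * x) / B (t * x)) / (e t / B t) * (B (t * x) / B t)
        = e (t * x) / e t"
      using eventually_gt_at_top[of 0]
    proof eventually_elim
      case (elim t)
      then have "B t > 0" "B (t * x) > 0" using B_pos x by auto
      then show ?case by (simp add: divide_simps)
    qed
    ultimately show ?thesis using Lim_transform_eventually k by force
  qed
  \<comment> \<open>any ratio strictly between \<open>q\<close> and 1 gives a geometric majorant of the increments\<close>
  define r where "r = (1 + q) / 2"
  have r: "0 < r" "r < 1" "q < r" using q by (auto simp: r_def)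
  have "\<forall>\<^sub>F t in at_top. \<bar>e (t * 2) / e t\<bar> < r"
  proof -
    have "((\<lambda>t. \<bar>e (t * 2) / e t\<bar>) \<longlongrightarrow> \<bar>q\<bar>) at_top"
      unfolding q_def by (intro tendsto_rabs e_rv) simp
    then show ?thesis using q r by (intro order_tendstoD) auto
  qed
  then have "\<forall>\<^sub>F t in at_top. \<bar>e (t * 2)\<bar> \<le> r * \<bar>e t\<bar>"
    using e_nz by eventually_elim (simp add: field_simps)
  then obtain T0 where T0: "\<And>t. t \<ge> T0 \<Longrightarrow> \<bar>e (t * 2)\<bar> \<le> r * \<bar>e t\<bar>"
    by (auto simp: eventually_at_top_linorder)
  define T where "T = max T0 w0"
  have T: "T \<ge> T0" "T \<ge> w0" "T > 0" using w0 by (auto simp: T_def)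
  have mono2: "t \<le> t * 2 ^ n" if "0 < t" for t :: real and n :: nat
    using that by (simp add: mult_le_cancel_left1)
  have geo: "\<bar>e (t * 2 ^ n)\<bar> \<le> r ^ n * \<bar>e t\<bar>" if t: "t \<ge> T" for t n
  proof (induction n)
    case (Suc n)
    have "T0 \<le> t * 2 ^ n" using mono2[of t n] t T by linarith
    then have "\<bar>e (t * 2 ^ Suc n)\<bar> \<le> r * \<bar>e (t * 2 ^ n)\<bar>"
      using T0[of "t * 2 ^ n"] by (simp add: mult_ac)
    also have "\<dots> \<le> r * (r ^ n * \<bar>e t\<bar>)" using Suc r by (intro mult_left_mono) auto
    finally show ?case by (simp add: mult_ac)
  qed simp
  have tannery: "((\<lambda>t. \<Sum>n. e (t * 2 ^ n) / e t) \<longlongrightarrow> (\<Sum>n. q ^ n)) at_top"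
  proof -
    have lim: "((\<lambda>t. e (t * 2 ^ n) / e t) \<longlongrightarrow> q ^ n) at_top" for n :: nat
      using e_rv[of "2 ^ n"] by (simp add: q_def powr_powr powr_realpow[symmetric] mult.commute)
    have "\<forall>\<^sub>F t in at_top. \<forall>n. norm (e (t * 2 ^ n) / e t) \<le> r ^ n"
      using e_nz eventually_ge_at_top[of T]
      by eventually_elim (use geo in \<open>auto simp: divide_simps abs_divide\<close>)
    then have bd: "\<forall>\<^sub>F (n, t) in at_top \<times>\<^sub>F at_top. norm (e (t * 2 ^ n) / e t) \<le> r ^ n"
      unfolding eventually_prod_filter by (intro exI[of _ "\<lambda>_. True"] exI conjI) auto
    show ?thesis
      using tannerys_theorem[OF lim bd] r by (simp add: summable_geometric)
  qed
  have sums: "(\<lambda>n. ln (slow_part (t * 2 ^ n))) \<longlonglongrightarrow> ln (slow_part t) + (\<Sum>n. e (t * 2 ^ n))" if t: "t \<ge> T" for t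
  proof -
    have "summable (\<lambda>n. e (t * 2 ^ n))"
      by (rule summable_comparison_test[of _ "\<lambda>n. r ^ n * \<bar>e t\<bar>"])
        (use geo[OF t] r in \<open>auto intro!: summable_mult2 summable_geometric\<close>)
    then have "(\<lambda>n. ln (slow_part t) + (\<Sum>i<n. e (t * 2 ^ i))) \<longlonglongrightarrow> ln (slow_part t) + (\<Sum>n. e (t * 2 ^ n))"
      by (intro tendsto_add tendsto_const summable_LIMSEQ)
    moreover have "ln (slow_part t) + (\<Sum>i<n. e (t * 2 ^ i)) = ln (slow_part (t * 2 ^ n))" for n
      by (induction n) (auto simp: e_def mult_ac)
    ultimately show ?thesis by simp
  qed
  define l where "l = ln (slow_part T) + (\<Sum>n. e (T * 2 ^ n))"
  have const: "ln (slow_part t) + (\<Sum>n. e (t * 2 ^ n)) = l" if t: "t \<ge> T" for t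
  proof -
    have pow: "filterlim (\<lambda>n. T * 2 ^ n :: real) at_top sequentially"
    proof (rule filterlim_tendsto_pos_mult_at_top[OF tendsto_const \<open>0 < T\<close>])
      have "filterlim (\<lambda>n. norm ((2 :: real) ^ n)) at_top sequentially"
        by (intro filterlim_at_infinity_imp_norm_at_top filterlim_realpow_sequentially_gt1) simp
      then show "filterlim (\<lambda>n. (2 :: real) ^ n) at_top sequentially" by simp
    qed
    have "(\<lambda>n. ln (slow_part (T * 2 ^ n * (t / T)) / slow_part (T * 2 ^ n))) \<longlonglongrightarrow> ln 1"
      by (intro tendsto_ln filterlim_compose[OF slow_part_ratio pow]) (use t T in auto)
    moreover have "ln (slow_part (T * 2 ^ n * (t / T)) / slow_part (T * 2 ^ n))
        = ln (slow_part (t * 2 ^ n)) - ln (slow_part (T * 2 ^ n))" for n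
    proof -
      have "T * 2 ^ n * (t / T) = t * 2 ^ n" using T by simp
      moreover have "slow_part (t * 2 ^ n) > 0" "slow_part (T * 2 ^ n) > 0"
      proof (rule_tac [!] slow_part_pos)
        show "w0 \<le> t * 2 ^ n" using mono2[of t n] t T by linarith
        show "w0 \<le> T * 2 ^ n" using mono2[of T n] t T by linarith
      qed
      ultimately show ?thesis by (simp add: ln_div)
    qed
    ultimately have "(\<lambda>n. ln (slow_part (t * 2 ^ n)) - ln (slow_part (T * 2 ^ n))) \<longlonglongrightarrow> 0" by simp
    moreover have "(\<lambda>n. ln (slow_part (t * 2 ^ n)) - ln (slow_part (T * 2 ^ n)))
        \<longlonglongrightarrow> (ln (slow_part t) + (\<Sum>n. e (t * 2 ^ n))) - l"
      unfolding l_def by (intro tendsto_diff sums t order_refl)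
    ultimately show ?thesis using LIMSEQ_unique by fastforce
  qed
  have "((\<lambda>t. - ((e t / B t) * (\<Sum>n. e (t * 2 ^ n) / e t))) \<longlongrightarrow> - (k * (\<Sum>n. q ^ n))) at_top"
    by (intro tendsto_intros eB tannery)
  moreover have "- (k * (\<Sum>n. q ^ n)) = \<gamma> / \<rho>"
    using q rho by (simp add: suminf_geometric k_def divide_simps) (simp add: algebra_simps)
  moreover have "\<forall>\<^sub>F t in at_top. - ((e t / B t) * (\<Sum>n. e (t * 2 ^ n) / e t))
      = (ln (slow_part t) - l) / B t"
    using e_nz eventually_ge_at_top[of T]
  proof eventually_elim
    case (elim t)
    have "summable (\<lambda>n. e (t * 2 ^ n))"
      by (rule summable_comparison_test[of _ "\<lambda>n. r ^ n * \<bar>e t\<bar>"])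
        (use geo[of t] elim r in \<open>auto intro!: summable_mult2 summable_geometric\<close>)
    then have "(\<Sum>n. e (t * 2 ^ n) / e t) = (\<Sum>n. e (t * 2 ^ n)) / e t"
      by (rule suminf_divide)
    moreover have "(\<Sum>n. e (t * 2 ^ n)) = l - ln (slow_part t)" using const elim by (simp add: algebra_simps)
    ultimately show ?case using elim by (simp add: minus_divide_left)
  qed
  ultimately have "((\<lambda>t. (ln (slow_part t) - l) / B t) \<longlongrightarrow> \<gamma> / \<rho>) at_top"
    by (rule Lim_transform_eventually[OF tendsto_eq_rhs])
  then have "((\<lambda>t. (exp ((ln (slow_part t) - l) / B t * B t) - 1) / B t) \<longlongrightarrow> 1 * (\<gamma> / \<rho>)) at_top"
    by (intro tendsto_secant[where f = "\<lambda>y. exp y - 1"] B_lim B_ev_nz) (auto intro!: derivative_eq_intros)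
  moreover have "\<forall>\<^sub>F t in at_top. (exp ((ln (slow_part t) - l) / B t * B t) - 1) / B t
      = (slow_part t / exp l - 1) / B t"
    using B_ev_nz eventually_ge_at_top[of w0]
    by eventually_elim (use slow_part_pos in \<open>simp add: exp_diff\<close>)
  ultimately have "((\<lambda>t. (slow_part t / exp l - 1) / B t) \<longlongrightarrow> \<gamma> / \<rho>) at_top"
    by (rule Lim_transform_eventually[THEN tendsto_eq_rhs]) simp
  then show thesis using that[of "exp l"] by simp
qed

text \<open>
  The relative error \<open>D\<close> inherits regular variation from \<open>B\<close>, to which it is asymptotically
  proportional, but unlike \<open>B\<close> it is continuous. So the uniform convergence theorem applies to it. The
  bound for all \<open>x \<ge> 1\<close> follows by iterating the one for \<open>x \<le> 2\<close>, since a doubling of the argument does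
  not increase \<open>\<bar>D\<bar>\<close> when \<open>\<rho> < 0\<close>.
\<close>

lemma slow_part_deviation_bound:
  assumes c: "0 < c" and lim: "((\<lambda>t. (slow_part t / c - 1) / B t) \<longlongrightarrow> b) at_top" and b: "b \<noteq> 0"
  defines "D \<equiv> \<lambda>w. slow_part w / c - 1"
  shows "\<And>t x x0. filterlim t at_top sequentially \<Longrightarrow> x \<longlonglongrightarrow> x0 \<Longrightarrow> 0 < x0 \<Longrightarrow>
      (\<lambda>n. D (t n * x n) / B (t n)) \<longlonglongrightarrow> b * x0 powr \<rho>" (is "\<And>t x x0. PROP ?seq t x x0")
    and "\<exists>T. \<forall>t\<ge>T. \<forall>x\<ge>1. \<bar>D (t * x)\<bar> \<le> (2 * \<bar>b\<bar> + 2) * B t"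
proof -
  have DB: "((\<lambda>t. D t / B t) \<longlongrightarrow> b) at_top" using lim by (simp add: D_def)
  have D_nz: "\<forall>\<^sub>F t in at_top. D t \<noteq> 0"
    using tendsto_imp_eventually_ne[OF DB b] by eventually_elim auto
  have D_rv: "((\<lambda>t. D (t * x) / D t) \<longlongrightarrow> x powr \<rho>) at_top" if x: "0 < x" for x
  proof -
    have "((\<lambda>t. (D (t * x) / B (t * x)) / (D t / B t) * (B (t * x) / B t)) \<longlongrightarrow> b / b * x powr \<rho>) at_top"
      by (intro tendsto_intros B_regularly_varying x DB b filterlim_compose[OF DB scale_at_top[OF x]])
    moreover have "\<forall>\<^sub>F t in at_top. (D (t * x) / B (t * x)) / (D t / B t) * (B (t * x) / B t)
        = D (t * x) / D t"
      using eventually_gt_at_top[of 0]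
    proof eventually_elim
      case (elim t)
      then have "B t > 0" "B (t * x) > 0" using B_pos x by auto
      then show ?case by (simp add: divide_simps)
    qed
    ultimately show ?thesis
      by (rule Lim_transform_eventually[THEN tendsto_eq_rhs]) (use b in simp)
  qed
  obtain w1 where w1: "\<And>w. w \<ge> w1 \<Longrightarrow> D w \<noteq> 0" "w1 \<ge> w0"
  proof -
    obtain a where "\<And>w. w \<ge> a \<Longrightarrow> D w \<noteq> 0"
      using D_nz by (auto simp: eventually_at_top_linorder)
    then show thesis using that[of "max a w0"] by auto
  qed
  have D_cont: "continuous_on {w1..} D"
    unfolding D_def slow_part_def
    by (intro continuous_intros continuous_on_subset[OF kappa_cont]) (use w1 w0 c in auto)
  have D_seq: "(\<lambda>n. D (t n * x n) / D (t n)) \<longlonglongrightarrow> x0 powr \<rho>"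
    if "filterlim t at_top sequentially" "x \<longlonglongrightarrow> x0" "0 < x0" for t x x0
    by (rule regularly_varying_sequentially[OF D_cont w1(1) D_rv that])
  show "PROP ?seq t x x0" for t x x0
  proof -
    assume as: "filterlim t at_top sequentially" "x \<longlonglongrightarrow> x0" "0 < x0"
    have "(\<lambda>n. D (t n * x n) / D (t n) * (D (t n) / B (t n))) \<longlonglongrightarrow> x0 powr \<rho> * b"
      by (intro tendsto_mult D_seq as filterlim_compose[OF DB])
    moreover have "\<forall>\<^sub>F n in sequentially. D (t n * x n) / D (t n) * (D (t n) / B (t n))
        = D (t n * x n) / B (t n)"
      using filterlim_iff[THEN iffD1, OF as(1), rule_format, OF D_nz] by eventually_elim simp
    ultimately show ?thesis
      by (rule Lim_transform_eventually[THEN tendsto_eq_rhs]) simp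
  qed
  have "\<exists>T. \<forall>t\<ge>T. \<forall>x\<in>{1..2}. \<bar>D (t * x)\<bar> \<le> 2 * \<bar>D t\<bar>"
  proof (rule ccontr)
    assume "\<not> ?thesis"
    then have "\<forall>n::nat. \<exists>t x. t \<ge> w1 + real n \<and> x \<in> {1..2} \<and> \<bar>D (t * x)\<bar> > 2 * \<bar>D t\<bar>"
      by (metis linorder_not_le)
    then obtain t x where tx: "\<And>n. t n \<ge> w1 + real n" "\<And>n. x n \<in> {1..2::real}"
      "\<And>n. \<bar>D (t n * x n)\<bar> > 2 * \<bar>D (t n)\<bar>"
      by metis
    obtain l r where l: "l \<in> {1..2::real}" "strict_mono r" "(x \<circ> r) \<longlonglongrightarrow> l"
      using compact_Icc[of 1 "2::real"] tx(2) unfolding compact_def by metis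
    have t: "filterlim t at_top sequentially"
    proof (rule filterlim_at_top_mono)
      show "filterlim (\<lambda>n. w1 + real n) at_top sequentially"
        by (rule filterlim_tendsto_add_at_top[OF tendsto_const filterlim_real_sequentially])
    qed (use tx in auto)
    have "(\<lambda>n. D ((t \<circ> r) n * (x \<circ> r) n) / D ((t \<circ> r) n)) \<longlonglongrightarrow> l powr \<rho>"
      using l by (intro D_seq) (auto simp: comp_def intro: filterlim_compose[OF t filterlim_subseq])
    then have "(\<lambda>n. \<bar>D ((t \<circ> r) n * (x \<circ> r) n) / D ((t \<circ> r) n)\<bar>) \<longlonglongrightarrow> \<bar>l powr \<rho>\<bar>"
      by (rule tendsto_rabs)
    moreover have "\<bar>l powr \<rho>\<bar> < 2"
      using l rho powr_mono2'[of \<rho> 1 l] by simp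
    ultimately have "\<forall>\<^sub>F n in sequentially. \<bar>D ((t \<circ> r) n * (x \<circ> r) n) / D ((t \<circ> r) n)\<bar> < 2"
      by (rule order_tendstoD)
    then obtain n where "\<bar>D (t (r n) * x (r n)) / D (t (r n))\<bar> < 2"
      by (auto dest: eventually_happens)
    moreover have "D (t (r n)) \<noteq> 0" using w1(1) tx(1)[of "r n"] by auto
    ultimately have "\<bar>D (t (r n) * x (r n))\<bar> < 2 * \<bar>D (t (r n))\<bar>"
      by (simp add: abs_divide divide_simps)
    then show False using tx(3)[of "r n"] by simp
  qed
  then obtain T1 where T1: "\<And>t x. t \<ge> T1 \<Longrightarrow> x \<in> {1..2} \<Longrightarrow> \<bar>D (t * x)\<bar> \<le> 2 * \<bar>D t\<bar>"
    by blast
  have "\<forall>\<^sub>F t in at_top. \<bar>D (t * 2) / D t\<bar> < 1"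
  proof -
    have "((\<lambda>t. \<bar>D (t * 2) / D t\<bar>) \<longlongrightarrow> \<bar>2 powr \<rho>\<bar>) at_top"
      by (intro tendsto_rabs D_rv) simp
    then show ?thesis using rho by (intro order_tendstoD) (auto simp: powr_less_one)
  qed
  then have "\<forall>\<^sub>F t in at_top. \<bar>D (t * 2)\<bar> \<le> \<bar>D t\<bar>"
    using D_nz by eventually_elim (simp add: abs_divide divide_simps)
  then obtain T2 where T2: "\<And>t. t \<ge> T2 \<Longrightarrow> \<bar>D (t * 2)\<bar> \<le> \<bar>D t\<bar>"
    by (auto simp: eventually_at_top_linorder)
  have "\<forall>\<^sub>F t in at_top. \<bar>D t / B t\<bar> < \<bar>b\<bar> + 1"
    by (rule order_tendstoD(2)[OF tendsto_rabs[OF DB]]) simp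
  then have "\<forall>\<^sub>F t in at_top. \<bar>D t\<bar> \<le> (\<bar>b\<bar> + 1) * B t"
    using eventually_gt_at_top[of 0]
  proof eventually_elim
    case (elim t)
    then have "B t > 0" using B_pos by auto
    then show ?case using elim by (simp add: abs_divide divide_simps)
  qed
  then obtain T3 where T3: "\<And>t. t \<ge> T3 \<Longrightarrow> \<bar>D t\<bar> \<le> (\<bar>b\<bar> + 1) * B t"
    by (auto simp: eventually_at_top_linorder)
  define T where "T = max (max T1 T2) (max T3 0)"
  have T: "T \<ge> T1" "T \<ge> T2" "T \<ge> T3" "T \<ge> 0" by (auto simp: T_def)
  have dyadic: "\<bar>D (t * x)\<bar> \<le> 2 * \<bar>D t\<bar>" if "t \<ge> T" "1 \<le> x" "x \<le> 2 ^ n" for t x n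
    using that
  proof (induction n arbitrary: t x)
    case 0
    then have "x = 1" by simp
    then show ?case by simp
  next
    case (Suc n)
    show ?case
    proof (cases "x \<le> 2")
      case True
      then show ?thesis using T1[of t x] Suc.prems T by simp
    next
      case False
      have "T \<le> t * 2" using Suc.prems T by linarith
      then have "\<bar>D (t * 2 * (x / 2))\<bar> \<le> 2 * \<bar>D (t * 2)\<bar>"
        using False Suc.prems by (intro Suc.IH) auto
      also have "\<dots> \<le> 2 * \<bar>D t\<bar>" using T2[of t] Suc.prems T by simp
      finally show ?thesis by simp
    qed
  qed
  have "\<bar>D (t * x)\<bar> \<le> (2 * \<bar>b\<bar> + 2) * B t" if "t \<ge> T" "x \<ge> 1" for t x
  proof -
    obtain n where "x < 2 ^ n" using real_arch_pow[of 2 x] by auto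
    then have "\<bar>D (t * x)\<bar> \<le> 2 * \<bar>D t\<bar>" using dyadic[of t x n] that by simp
    also have "\<dots> \<le> 2 * ((\<bar>b\<bar> + 1) * B t)" using T3[of t] that T by simp
    finally show ?thesis by (simp add: algebra_simps)
  qed
  then show "\<exists>T. \<forall>t\<ge>T. \<forall>x\<ge>1. \<bar>D (t * x)\<bar> \<le> (2 * \<bar>b\<bar> + 2) * B t" by blast
qed

text \<open>
  The second order expansion of \<open>s powr \<alpha> * \<kappa> (s / z)\<close>, locally uniformly in \<open>z\<close> up to and including
  \<open>z = 0\<close>. Away from 0 this is regular variation of the relative error; near 0 the error at \<open>s / z\<close> is at
  most a multiple of \<open>B s\<close>, and the factor \<open>z powr \<alpha>\<close> makes it negligible. At \<open>z = 0\<close> the convention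
  \<open>s / 0 = 0\<close> meets the assumption \<open>\<kappa> 0 = 0\<close>.
\<close>

lemma second_order_expansion:
  assumes kappa_0: "\<kappa> 0 = 0"
  obtains c where "0 < c" "\<And>s z z0. filterlim s at_top sequentially \<Longrightarrow> z \<longlonglongrightarrow> z0 \<Longrightarrow> (\<And>n. 0 \<le> z n) \<Longrightarrow>
    (\<lambda>n. (s n powr \<alpha> * \<kappa> (s n / z n) - c * z n powr \<alpha>) / B (s n)) \<longlonglongrightarrow> c * (\<gamma> / \<rho>) * z0 powr (\<alpha> - \<rho>)"
proof -
  obtain c where c: "0 < c" and lim: "((\<lambda>t. (slow_part t / c - 1) / B t) \<longlongrightarrow> \<gamma> / \<rho>) at_top"
    by (rule slow_part_limit)
  define b where "b = \<gamma> / \<rho>"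
  have b: "b \<noteq> 0" using gamma rho by (simp add: b_def)
  define D where "D w = slow_part w / c - 1" for w
  note bounds = slow_part_deviation_bound[OF c lim[folded b_def] b, folded D_def]
  obtain T where T: "\<And>t x. t \<ge> T \<Longrightarrow> x \<ge> 1 \<Longrightarrow> \<bar>D (t * x)\<bar> \<le> (2 * \<bar>b\<bar> + 2) * B t"
    using bounds(2) by blast
  have eq: "s powr \<alpha> * \<kappa> (s / z) - c * z powr \<alpha> = c * z powr \<alpha> * D (s * (1 / z))" if "0 < s" "0 \<le> z" for s z
    using that c by (cases "z = 0") (auto simp: kappa_0 D_def slow_part_def powr_divide field_simps)
  have "(\<lambda>n. (s n powr \<alpha> * \<kappa> (s n / z n) - c * z n powr \<alpha>) / B (s n)) \<longlonglongrightarrow> c * b * z0 powr (\<alpha> - \<rho>)"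
    if s: "filterlim s at_top sequentially" and z: "z \<longlonglongrightarrow> z0" and z_nonneg: "\<And>n. 0 \<le> z n" for s z z0
  proof -
    have z0: "0 \<le> z0" using LIMSEQ_le_const[OF z] z_nonneg by blast
    have spos: "\<forall>\<^sub>F n in sequentially. s n > max T 0"
      using s unfolding filterlim_at_top_dense by blast
    have lim1: "(\<lambda>n. c * z n powr \<alpha> * (D (s n * (1 / z n)) / B (s n))) \<longlonglongrightarrow> c * b * z0 powr (\<alpha> - \<rho>)"
    proof (cases "z0 = 0")
      case False
      with z0 have p: "z0 > 0" by simp
      have "(\<lambda>n. c * z n powr \<alpha> * (D (s n * (1 / z n)) / B (s n))) \<longlonglongrightarrow> c * z0 powr \<alpha> * (b * (1 / z0) powr \<rho>)"
        using p by (intro tendsto_intros bounds(1) s z) auto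
      then show ?thesis using p by (simp add: powr_diff powr_divide mult_ac)
    next
      case True
      have "(\<lambda>n. c * z n powr \<alpha> * (2 * \<bar>b\<bar> + 2)) \<longlonglongrightarrow> c * 0 powr \<alpha> * (2 * \<bar>b\<bar> + 2)"
        using z True alpha z_nonneg by (intro tendsto_intros tendsto_powr') auto
      then have *: "(\<lambda>n. c * z n powr \<alpha> * (2 * \<bar>b\<bar> + 2)) \<longlonglongrightarrow> 0" by simp
      have "\<forall>\<^sub>F n in sequentially. z n < 1"
        using z True by (intro order_tendstoD) auto
      with spos have "\<forall>\<^sub>F n in sequentially. norm (c * z n powr \<alpha> * (D (s n * (1 / z n)) / B (s n)))
          \<le> c * z n powr \<alpha> * (2 * \<bar>b\<bar> + 2)"
      proof eventually_elim
        case (elim n)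
        show ?case
        proof (cases "z n = 0")
          case False
          with z_nonneg[of n] have zp: "z n > 0" by simp
          have Bp: "B (s n) > 0" using elim B_pos by simp
          have "\<bar>D (s n * (1 / z n))\<bar> \<le> (2 * \<bar>b\<bar> + 2) * B (s n)"
            using elim zp by (intro T) auto
          then have "\<bar>D (s n * (1 / z n)) / B (s n)\<bar> \<le> 2 * \<bar>b\<bar> + 2"
            using Bp by (simp add: abs_divide divide_simps)
          then have "c * z n powr \<alpha> * \<bar>D (s n * (1 / z n)) / B (s n)\<bar> \<le> c * z n powr \<alpha> * (2 * \<bar>b\<bar> + 2)"
            using c by (intro mult_left_mono) auto
          then show ?thesis using c by (simp add: abs_mult)
        qed simp
      qed
      from Lim_null_comparison[OF this *] show ?thesis using True by simp
    qed
    have "\<forall>\<^sub>F n in sequentially. c * z n powr \<alpha> * (D (s n * (1 / z n)) / B (s n))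
        = (s n powr \<alpha> * \<kappa> (s n / z n) - c * z n powr \<alpha>) / B (s n)"
      using spos by eventually_elim (use eq z_nonneg in simp)
    with lim1 show ?thesis by (rule Lim_transform_eventually)
  qed
  with c that show thesis by (simp add: b_def)
qed

end

section \<open>Uniform convergence from sequences\<close>

text \<open>
  Continuous convergence on a compact set is uniform. Continuity of the limit is a consequence here: on
  a sequence of bad points \<open>x n\<close>, the values \<open>S (x n)\<close> are replaced by values of \<open>f\<close> at the same points
  and parameters \<open>T + m n\<close> at which pointwise convergence has set in.
\<close>

lemma uniform_limit_compactI:
  fixes f :: "real \<Rightarrow> 'a :: metric_space \<Rightarrow> 'b :: metric_space"
  assumes K: "compact K"
    and lim: "\<And>t x x0. (\<And>n. T \<le> t n) \<Longrightarrow> filterlim t at_top sequentially \<Longrightarrow> (\<And>n. x n \<in> K) \<Longrightarrow> x \<longlonglongrightarrow> x0 \<Longrightarrow> x0 \<in> K \<Longrightarrow>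
      (\<lambda>n. f (t n) (x n)) \<longlonglongrightarrow> S x0"
  shows "uniform_limit K f S at_top"
proof (rule ccontr)
  assume "\<not> ?thesis"
  then obtain e where e: "0 < e" and "\<not> (\<forall>\<^sub>F t in at_top. \<forall>x\<in>K. dist (f t x) (S x) < e)"
    by (auto simp: uniform_limit_iff)
  then have "\<forall>n::nat. \<exists>t x. T + real n \<le> t \<and> x \<in> K \<and> e \<le> dist (f t x) (S x)"
    unfolding eventually_at_top_linorder by (metis linorder_not_le)
  then obtain t x where tx: "\<And>n. T + real n \<le> t n" "\<And>n. x n \<in> K" "\<And>n. e \<le> dist (f (t n) (x n)) (S (x n))"
    by metis
  have "\<exists>m::nat. n \<le> m \<and> dist (f (T + real m) (x n)) (S (x n)) < e / 2" for n
  proof -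
    have "(\<lambda>m. f (T + real m) (x n)) \<longlonglongrightarrow> S (x n)"
      using tx(2) by (intro lim filterlim_tendsto_add_at_top[OF tendsto_const filterlim_real_sequentially] tendsto_const) auto
    then have "\<forall>\<^sub>F m in sequentially. dist (f (T + real m) (x n)) (S (x n)) < e / 2"
      using e by (intro tendstoD) auto
    moreover have "\<forall>\<^sub>F m in sequentially. n \<le> m" by (rule eventually_ge_at_top)
    ultimately have "\<forall>\<^sub>F m in sequentially. n \<le> m \<and> dist (f (T + real m) (x n)) (S (x n)) < e / 2"
      by eventually_elim simp
    then show ?thesis by (auto dest: eventually_happens)
  qed
  then obtain m where m: "\<And>n. n \<le> m n" "\<And>n. dist (f (T + real (m n)) (x n)) (S (x n)) < e / 2"
    by metis
  obtain x0 r where r: "x0 \<in> K" "strict_mono r" "(x \<circ> r) \<longlonglongrightarrow> x0"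
    using K tx(2) unfolding compact_def by metis
  from r(3) have xr: "(\<lambda>n. x (r n)) \<longlonglongrightarrow> x0" by (simp add: comp_def)
  have large: "filterlim (\<lambda>n. u (r n)) at_top sequentially" if "\<And>n. T + real n \<le> u n" for u :: "nat \<Rightarrow> real"
    by (rule filterlim_at_top_mono[OF filterlim_tendsto_add_at_top[OF tendsto_const[of T]
            filterlim_compose[OF filterlim_real_sequentially filterlim_subseq[OF r(2)]]]])
      (use that in auto)
  have "(\<lambda>n. f (t (r n)) (x (r n))) \<longlonglongrightarrow> S x0"
    using tx(2) r(1) xr by (intro lim large tx(1) order_trans[OF _ tx(1)]) auto
  moreover have "(\<lambda>n. f (T + real (m (r n))) (x (r n))) \<longlonglongrightarrow> S x0"
    using m tx(2) r(1) xr by (intro lim large) auto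
  ultimately have "(\<lambda>n. dist (f (t (r n)) (x (r n))) (f (T + real (m (r n))) (x (r n))))
      \<longlonglongrightarrow> dist (S x0) (S x0)"
    by (rule tendsto_dist)
  then have "\<forall>\<^sub>F n in sequentially. dist (f (t (r n)) (x (r n))) (f (T + real (m (r n))) (x (r n))) < e / 2"
    using e by (intro order_tendstoD) auto
  then obtain n where "dist (f (t (r n)) (x (r n))) (f (T + real (m (r n))) (x (r n))) < e / 2"
    by (auto dest: eventually_happens)
  then show False
    using tx(3)[of "r n"] m(2)[of "r n"] dist_triangle[of "f (t (r n)) (x (r n))" "S (x (r n))" "f (T
        + real (m (r n))) (x (r n))"]
    by linarith
qed

section \<open>Stable tail dependence functions\<close>

lemma copula_margin:
  assumes M: "prob_space M" "sets M = sets borel"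
    and margin: "distr M borel (\<lambda>x. x $ j) = uniform_measure lborel {0..1}"
    and S: "S \<in> sets borel"
  shows "measure M {x :: real ^ 'n. x $ j \<in> S} = measure lborel ({0..1} \<inter> S)"
proof -
  have meas: "(\<lambda>x. x $ j) \<in> borel_measurable M"
    using M(2) by (simp add: measurable_cong_sets[OF M(2) refl])
  have sp: "space M = UNIV" using sets_eq_imp_space_eq[OF M(2)] by simp
  have "measure (distr M borel (\<lambda>x. x $ j)) S = measure M {x. x $ j \<in> S}"
    by (subst measure_distr[OF meas S]) (simp add: vimage_def sp)
  moreover have "measure (uniform_measure lborel {0..1}) S = measure lborel ({0..1} \<inter> S)"
    using S by (subst measure_uniform_measure) auto
  ultimately show ?thesis using margin by simp
qed

lemma copula_le_margin:
  fixes C :: "real ^ 'n \<Rightarrow> real"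
  assumes C: "is_copula C" and u: "u \<in> {0..1}"
  shows "C u \<le> u $ j"
proof -
  obtain M where M: "prob_space M" "sets M = sets borel"
    "\<And>j. distr M borel (\<lambda>x. x $ j) = uniform_measure lborel {0..1}" and Cu: "\<And>u. u \<in> {0..1} \<Longrightarrow>
        C u = measure M {..u}"
    using C unfolding is_copula_def by blast
  interpret prob_space M by (rule M)
  have "C u = measure M {..u}" using Cu u by simp
  also have "\<dots> \<le> measure M {x. x $ j \<in> {..u $ j}}"
    by (rule finite_measure_mono) (auto simp: M less_eq_vec_def)
  also have "\<dots> = measure lborel ({0..1} \<inter> {..u $ j})"
    by (rule copula_margin) (use M in auto)
  also have "{0..1} \<inter> {..u $ j} = {0..u $ j}" using u by (auto simp: less_eq_vec_def intro: order_trans)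
  also have "measure lborel {0..u $ j} = u $ j" using u by (auto simp: less_eq_vec_def)
  finally show ?thesis .
qed

text \<open>
  A point below \<open>v\<close> but not below \<open>u\<close> lies in one of the slabs between \<open>u\<^sub>j\<close> and \<open>v\<^sub>j\<close>, whose mass is
  \<open>v\<^sub>j - u\<^sub>j\<close> by uniformity of the margins.
\<close>

lemma copula_increment:
  fixes C :: "real ^ 'n \<Rightarrow> real"
  assumes C: "is_copula C" and u: "0 \<le> u" "u \<le> v" "v \<le> 1"
  shows "C u \<le> C v" and "C v - C u \<le> (\<Sum>j\<in>UNIV. v $ j - u $ j)"
proof -
  obtain M where M: "prob_space M" "sets M = sets borel"
    "\<And>j. distr M borel (\<lambda>x. x $ j) = uniform_measure lborel {0..1}" and Cu: "\<And>u. u \<in> {0..1} \<Longrightarrow>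
        C u = measure M {..u}"
    using C unfolding is_copula_def by blast
  interpret prob_space M by (rule M)
  have uv: "u \<in> {0..1}" "v \<in> {0..1}" using u by (auto intro: order_trans)
  have sets: "{..w} \<in> sets M" "{x :: real ^ 'n. x $ j \<in> {a<..b}} \<in> sets M" for w a b j
    by (auto simp: M)
  show "C u \<le> C v"
    using u uv by (simp add: Cu) (rule finite_measure_mono, auto simp: sets intro: order_trans)
  have "C v - C u = measure M ({..v} - {..u})"
    using u uv sets by (subst finite_measure_Diff) (auto simp: Cu intro: order_trans)
  also have "\<dots> \<le> measure M (\<Union>j. {x. x $ j \<in> {u $ j<..v $ j}})"
    by (rule finite_measure_mono) (use sets in \<open>auto simp: less_eq_vec_def simp flip: not_less\<close>)
  also have "\<dots> \<le> (\<Sum>j\<in>UNIV. measure M {x. x $ j \<in> {u $ j<..v $ j}})"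
    by (rule finite_measure_subadditive_finite) (use sets in auto)
  also have "\<dots> = (\<Sum>j\<in>UNIV. v $ j - u $ j)"
  proof (rule sum.cong[OF refl])
    fix j
    have "measure M {x. x $ j \<in> {u $ j<..v $ j}} = measure lborel ({0..1} \<inter> {u $ j<..v $ j})"
      by (rule copula_margin) (use M in auto)
    also have "{0..1} \<inter> {u $ j<..v $ j} = {u $ j<..v $ j}"
      using u by (auto simp: less_eq_vec_def) (metis less_le_trans less_eq_real_def order_trans)+
    also have "measure lborel \<dots> = v $ j - u $ j" using u by (auto simp: less_eq_vec_def)
    finally show "measure M {x. x $ j \<in> {u $ j<..v $ j}} = v $ j - u $ j" .
  qed
  finally show "C v - C u \<le> (\<Sum>j\<in>UNIV. v $ j - u $ j)" .
qed

definition vec_exp_neg :: "real ^ 'n \<Rightarrow> real ^ 'n" where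
  "vec_exp_neg x = (\<chi> j. exp (- (x $ j)))"

lemma stdf_copula_vec_exp_neg: "stdf_copula L (vec_exp_neg x) = exp (- L x)"
  by (simp add: stdf_copula_def vec_exp_neg_def)

lemma vec_exp_neg_range: "0 \<le> x \<Longrightarrow> vec_exp_neg x \<in> {0..1}"
  by (simp add: vec_exp_neg_def less_eq_vec_def)

lemma vec_powr_vec_exp_neg: "vec_powr (vec_exp_neg x) a = vec_exp_neg (a *\<^sub>R x)"
  by (simp add: vec_powr_def vec_exp_neg_def powr_def vec_eq_iff)

text \<open>
  The analytic properties of \<open>L\<close> are read off from its copula at the points \<open>exp (- x)\<close>: max-stability
  is homogeneity, the uniform margins give \<open>x\<^sub>j \<le> L x\<close>, and the increments of a copula bound those of \<open>L\<close>.
\<close>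

context
  fixes L :: "real ^ 'n \<Rightarrow> real"
  assumes L: "stable_tail_dependence L"
begin

lemma stdf_nonneg: "0 \<le> x \<Longrightarrow> 0 \<le> L x"
  using L by (simp add: stable_tail_dependence_def)

lemma stdf_homogeneous:
  assumes x: "0 \<le> x" and s: "0 < s"
  shows "L (s *\<^sub>R x) = s * L x"
proof -
  have "stdf_copula L (vec_powr (vec_exp_neg x) (1 / (1 / s))) powr (1 / s) = stdf_copula L (vec_exp_neg x)"
    using L vec_exp_neg_range[OF x] s unfolding stable_tail_dependence_def extreme_value_copula_def
    by (metis zero_less_divide_1_iff)
  then have "exp (- L (s *\<^sub>R x)) powr (1 / s) = exp (- L x)"
    by (simp add: vec_powr_vec_exp_neg stdf_copula_vec_exp_neg)
  then have "L (s *\<^sub>R x) / s = L x" by (simp add: powr_def)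
  then show ?thesis using s by (simp add: field_simps)
qed

lemma stdf_ge_component:
  assumes x: "0 \<le> x"
  shows "x $ j \<le> L x"
  using copula_le_margin[of "stdf_copula L" "vec_exp_neg x" j] L vec_exp_neg_range[OF x]
  by (simp add: stdf_copula_vec_exp_neg stable_tail_dependence_def extreme_value_copula_def)
    (simp add: vec_exp_neg_def)

lemma stdf_mono:
  assumes x: "0 \<le> x" and xy: "x \<le> y"
  shows "L x \<le> L y"
proof -
  have "stdf_copula L (vec_exp_neg y) \<le> stdf_copula L (vec_exp_neg x)"
    using L vec_exp_neg_range[OF x] vec_exp_neg_range[OF order_trans[OF x xy]] xy
    by (intro copula_increment(1)) (auto simp: stable_tail_dependence_def extreme_value_copula_def vec_exp_neg_def less_eq_vec_def)
  then show ?thesis by (simp add: stdf_copula_vec_exp_neg)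
qed

text \<open>
  The copula bound at \<open>exp (- h * x)\<close> and \<open>exp (- h * y)\<close>, divided by \<open>h\<close>, becomes the claim as
  \<open>h \<rightarrow> 0\<close>, because \<open>L (h * x) = h * L x\<close>.
\<close>

lemma stdf_increment:
  assumes x: "0 \<le> x" and xy: "x \<le> y"
  shows "L y - L x \<le> (\<Sum>j\<in>UNIV. y $ j - x $ j)"
proof (rule tendsto_le)
  have secant: "((\<lambda>h. (exp (- (h * a)) - exp (- (h * b))) / h) \<longlongrightarrow> b - a) (at_right 0)" for a b :: real
  proof -
    have "((\<lambda>h. exp (- (h * a)) - exp (- (h * b))) has_real_derivative (b - a)) (at 0)"
      by (auto intro!: derivative_eq_intros)
    then have "((\<lambda>h. (exp (- (h * a)) - exp (- (h * b))) / h) \<longlongrightarrow> b - a) (at 0)"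
      by (simp add: has_field_derivative_iff)
    then show ?thesis by (rule filterlim_mono) (auto simp: at_within_le_at)
  qed
  show "((\<lambda>h. (exp (- (h * L x)) - exp (- (h * L y))) / h) \<longlongrightarrow> L y - L x) (at_right 0)"
    by (rule secant)
  show "((\<lambda>h. \<Sum>j\<in>UNIV. (exp (- (h * x $ j)) - exp (- (h * y $ j))) / h) \<longlongrightarrow> (\<Sum>j\<in>UNIV. y $ j
      - x $ j)) (at_right 0)"
    by (intro tendsto_sum secant)
  have "(exp (- (h * L x)) - exp (- (h * L y))) / h \<le> (\<Sum>j\<in>UNIV. (exp (- (h * x $ j))
      - exp (- (h * y $ j))) / h)"
    if h: "0 < h" for h
  proof -
    have y: "0 \<le> y" using x xy by (rule order_trans)
    have hx: "0 \<le> h *\<^sub>R x" "0 \<le> h *\<^sub>R y" using h x y by (auto simp: less_eq_vec_def)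
    have "stdf_copula L (vec_exp_neg (h *\<^sub>R x)) - stdf_copula L (vec_exp_neg (h *\<^sub>R y))
      \<le> (\<Sum>j\<in>UNIV. vec_exp_neg (h *\<^sub>R x) $ j - vec_exp_neg (h *\<^sub>R y) $ j)"
      using L vec_exp_neg_range[OF hx(1)] vec_exp_neg_range[OF hx(2)] xy h
      by (intro copula_increment(2)) (auto simp: stable_tail_dependence_def extreme_value_copula_def vec_exp_neg_def less_eq_vec_def mult_left_mono)
    then show ?thesis
      unfolding stdf_copula_vec_exp_neg stdf_homogeneous[OF x h] stdf_homogeneous[OF y h]
      using h by (simp add: vec_exp_neg_def sum_divide_distrib[symmetric] divide_right_mono)
  qed
  then show "\<forall>\<^sub>F h in at_right 0. (exp (- (h * L x)) - exp (- (h * L y))) / h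
      \<le> (\<Sum>j\<in>UNIV. (exp (- (h * x $ j)) - exp (- (h * y $ j))) / h)"
    by (auto simp: eventually_at_right_field intro!: exI[of _ 1])
qed simp

lemma stdf_lipschitz:
  assumes x: "0 \<le> x" and y: "0 \<le> y"
  shows "\<bar>L x - L y\<bar> \<le> (\<Sum>j\<in>UNIV. \<bar>x $ j - y $ j\<bar>)"
proof -
  have *: "L x - L y \<le> (\<Sum>j\<in>UNIV. \<bar>x $ j - y $ j\<bar>)" if x: "0 \<le> x" and y: "0 \<le> y" for x y :: "real ^ 'n"
  proof -
    define z where "z = (\<chi> j. max (x $ j) (y $ j))"
    have z: "x \<le> z" "y \<le> z" by (auto simp: z_def less_eq_vec_def)
    have "L x - L y \<le> L z - L y" using stdf_mono[OF x z(1)] by simp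
    also have "\<dots> \<le> (\<Sum>j\<in>UNIV. z $ j - y $ j)" by (rule stdf_increment[OF y z(2)])
    also have "\<dots> \<le> (\<Sum>j\<in>UNIV. \<bar>x $ j - y $ j\<bar>)" by (intro sum_mono) (auto simp: z_def)
    finally show ?thesis .
  qed
  show ?thesis using *[OF x y] *[OF y x] by (auto simp: abs_le_iff abs_minus_commute)
qed

lemma stdf_tendsto:
  assumes x: "(x \<longlongrightarrow> x0) F" and nonneg: "\<And>n. 0 \<le> x n" and x0: "0 \<le> x0"
  shows "((\<lambda>n. L (x n)) \<longlongrightarrow> L x0) F"
proof -
  have "((\<lambda>n. \<Sum>j\<in>UNIV. \<bar>x n $ j - x0 $ j\<bar>) \<longlongrightarrow> (\<Sum>j\<in>UNIV. \<bar>x0 $ j - x0 $ j\<bar>)) F"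
    by (intro tendsto_intros x)
  then have "((\<lambda>n. \<Sum>j\<in>UNIV. \<bar>x n $ j - x0 $ j\<bar>) \<longlongrightarrow> 0) F" by simp
  moreover have "\<forall>\<^sub>F n in F. norm (L (x n) - L x0) \<le> (\<Sum>j\<in>UNIV. \<bar>x n $ j - x0 $ j\<bar>)"
    using stdf_lipschitz nonneg x0 by simp
  ultimately have "((\<lambda>n. L (x n) - L x0) \<longlongrightarrow> 0) F" by (rule Lim_null_comparison[rotated])
  then show ?thesis by (simp add: LIM_zero_iff)
qed

end

section \<open>The attractor and its partial derivatives\<close>

lemma powr_increment_antimono:
  fixes \<alpha> :: real
  assumes "0 < \<alpha>" "\<alpha> \<le> 1" "0 \<le> p" "p \<le> q" "0 \<le> k"
  shows "(q + k) powr \<alpha> - q powr \<alpha> \<le> (p + k) powr \<alpha> - p powr \<alpha>"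
proof (rule DERIV_nonpos_imp_decreasing_open[OF \<open>p \<le> q\<close>])
  fix t assume t: "p < t" "t < q"
  have "((\<lambda>t. (t + k) powr \<alpha> - t powr \<alpha>) has_real_derivative \<alpha> * (t + k) powr (\<alpha> - 1) - \<alpha> * t powr (\<alpha>
      - 1)) (at t)"
    using t assms by (auto intro!: derivative_eq_intros)
  moreover have "(t + k) powr (\<alpha> - 1) \<le> t powr (\<alpha> - 1)"
    using t assms by (intro powr_mono2') auto
  ultimately show "\<exists>y. ((\<lambda>t. (t + k) powr \<alpha> - t powr \<alpha>) has_real_derivative y) (at t) \<and> y \<le> 0"
    using assms by (intro exI conjI) (auto simp: mult_left_mono)
next
  show "continuous_on {p..q} (\<lambda>t. (t + k) powr \<alpha> - t powr \<alpha>)"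
    using assms by (intro continuous_intros continuous_on_powr') auto
qed

lemma vec_powr_tendsto:
  assumes "(x \<longlongrightarrow> x0) F" "\<And>n. 0 \<le> x n" "0 < a"
  shows "((\<lambda>n. vec_powr (x n) a) \<longlongrightarrow> vec_powr x0 a) F"
  unfolding vec_powr_def
proof (rule tendsto_vec_lambda)
  fix j
  show "((\<lambda>n. x n $ j powr a) \<longlongrightarrow> x0 $ j powr a) F"
    using assms by (intro tendsto_powr' tendsto_vec_nth tendsto_const) (auto simp: less_eq_vec_def)
qed

lemma vec_powr_nonneg: "0 \<le> vec_powr x a"
  by (simp add: vec_powr_def less_eq_vec_def)

text \<open>
  The partial derivative of \<^const>\<open>attractor_stdf\<close> as given by the chain rule; the factors \<open>\<alpha>\<close> from
  the outer and \<open>1 / \<alpha>\<close> from the inner power cancel.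
\<close>

definition attractor_partial :: "(real ^ 'n \<Rightarrow> real) \<Rightarrow> real \<Rightarrow> 'n \<Rightarrow> real ^ 'n \<Rightarrow> real" where
  "attractor_partial L \<alpha> j x = L (vec_powr x (1 / \<alpha>)) powr (\<alpha> - 1) *
     partial_deriv L j (vec_powr x (1 / \<alpha>)) * x $ j powr (1 / \<alpha> - 1)"

context
  fixes L :: "real ^ 'n \<Rightarrow> real" and \<alpha> :: real
  assumes L: "stable_tail_dependence L" and alpha: "0 < \<alpha>" "\<alpha> \<le> 1"
begin

lemma attractor_homogeneous:
  assumes x: "0 \<le> x" and s: "0 < s"
  shows "attractor_stdf L \<alpha> (s *\<^sub>R x) = s * attractor_stdf L \<alpha> x"
proof -
  have "vec_powr (s *\<^sub>R x) (1 / \<alpha>) = s powr (1 / \<alpha>) *\<^sub>R vec_powr x (1 / \<alpha>)"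
    using x s by (auto simp: vec_powr_def vec_eq_iff powr_mult less_eq_vec_def)
  then show ?thesis
    using s alpha stdf_nonneg[OF L vec_powr_nonneg]
    by (simp add: attractor_stdf_def stdf_homogeneous[OF L vec_powr_nonneg] powr_mult powr_powr)
qed

lemma attractor_ge_component:
  assumes x: "0 \<le> x"
  shows "x $ j \<le> attractor_stdf L \<alpha> x"
proof -
  have "x $ j = (x $ j powr (1 / \<alpha>)) powr \<alpha>"
    using x alpha by (simp add: powr_powr less_eq_vec_def)
  also have "\<dots> \<le> L (vec_powr x (1 / \<alpha>)) powr \<alpha>"
    using stdf_ge_component[OF L vec_powr_nonneg, of x "1 / \<alpha>" j] alpha
    by (intro powr_mono2) (auto simp: vec_powr_def)
  finally show ?thesis by (simp add: attractor_stdf_def)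
qed

lemma vec_powr_shift:
  "vec_powr (x + h *\<^sub>R axis j 1) a = vec_powr x a + ((x $ j + h) powr a - x $ j powr a) *\<^sub>R axis j 1"
  by (auto simp: vec_powr_def vec_eq_iff axis_def)

text \<open>
  The attractor is Lipschitz with constant 1 in every coordinate, although the outer power \<open>\<alpha>\<close> may have
  an infinite slope at 0: since \<open>L v \<ge> v\<^sub>j\<close>, concavity bounds the increment of \<open>L v powr \<alpha>\<close> by that of
  \<open>v\<^sub>j powr \<alpha>\<close>, which is exactly \<open>h\<close>.
\<close>

lemma attractor_increment:
  assumes x: "0 \<le> x" and h: "0 \<le> h"
  shows "0 \<le> attractor_stdf L \<alpha> (x + h *\<^sub>R axis j 1) - attractor_stdf L \<alpha> x"
    and "attractor_stdf L \<alpha> (x + h *\<^sub>R axis j 1) - attractor_stdf L \<alpha> x \<le> h"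
proof -
  define v where "v = vec_powr x (1 / \<alpha>)"
  define k where "k = (x $ j + h) powr (1 / \<alpha>) - x $ j powr (1 / \<alpha>)"
  have xj: "0 \<le> x $ j" using x by (simp add: less_eq_vec_def)
  have k: "0 \<le> k" using xj h alpha by (simp add: k_def powr_mono2)
  have v: "0 \<le> v" "v \<le> v + k *\<^sub>R axis j 1"
    using k by (auto simp: v_def vec_powr_def less_eq_vec_def axis_def)
  have shift: "vec_powr (x + h *\<^sub>R axis j 1) (1 / \<alpha>) = v + k *\<^sub>R axis j 1"
    by (simp add: vec_powr_shift v_def k_def)
  have lo: "L v \<le> L (v + k *\<^sub>R axis j 1)" by (rule stdf_mono[OF L v])
  have "L (v + k *\<^sub>R axis j 1) - L v \<le> (\<Sum>i\<in>UNIV. (v + k *\<^sub>R axis j 1) $ i - v $ i)"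
    by (rule stdf_increment[OF L v])
  also have "\<dots> = (\<Sum>i\<in>UNIV. if i = j then k else 0)" by (intro sum.cong) (auto simp: axis_def)
  also have "\<dots> = k" by simp
  finally have hi: "L (v + k *\<^sub>R axis j 1) \<le> L v + k" by simp
  have Lv: "0 \<le> L v" "v $ j \<le> L v" "0 \<le> v $ j"
    using stdf_nonneg[OF L v(1)] stdf_ge_component[OF L v(1)] v(1) by (auto simp: less_eq_vec_def)
  show "0 \<le> attractor_stdf L \<alpha> (x + h *\<^sub>R axis j 1) - attractor_stdf L \<alpha> x"
    using lo Lv alpha by (simp add: attractor_stdf_def shift v_def[symmetric] powr_mono2)
  have "attractor_stdf L \<alpha> (x + h *\<^sub>R axis j 1) - attractor_stdf L \<alpha> x \<le> (L v + k) powr \<alpha> - L v powr \<alpha>"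
    using lo hi Lv alpha by (simp add: attractor_stdf_def shift v_def[symmetric] powr_mono2)
  also have "\<dots> \<le> (v $ j + k) powr \<alpha> - v $ j powr \<alpha>"
    using alpha Lv k by (intro powr_increment_antimono) auto
  also have "\<dots> = h"
    using xj h alpha by (simp add: v_def k_def vec_powr_def powr_powr)
  finally show "attractor_stdf L \<alpha> (x + h *\<^sub>R axis j 1) - attractor_stdf L \<alpha> x \<le> h" .
qed

lemma attractor_has_partial:
  assumes smooth: "has_continuous_partials L" and x: "0 \<le> x" "0 < x $ j"
  shows "((\<lambda>h. attractor_stdf L \<alpha> (x + h *\<^sub>R axis j 1)) has_real_derivative attractor_partial L \<alpha> j x)
      (at 0)"
proof -
  define v where "v = vec_powr x (1 / \<alpha>)"
  define k where "k h = (x $ j + h) powr (1 / \<alpha>) - x $ j powr (1 / \<alpha>)" for h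
  define \<phi> where "\<phi> k = L (v + k *\<^sub>R axis j 1)" for k
  have v: "0 \<le> v" "0 < v $ j" using x by (auto simp: v_def vec_powr_nonneg) (simp add: vec_powr_def)
  have Lv: "0 < L v" using stdf_ge_component[OF L v(1), of j] v by simp
  have "\<phi> differentiable (at 0)"
    unfolding \<phi>_def using smooth v by (simp add: has_continuous_partials_def)
  then have d1: "(\<phi> has_real_derivative partial_deriv L j v) (at 0)"
    unfolding partial_deriv_def \<phi>_def by (rule DERIV_deriv_iff_real_differentiable[THEN iffD2])
  have k0: "k 0 = 0" by (simp add: k_def)
  have d2: "(k has_real_derivative 1 / \<alpha> * x $ j powr (1 / \<alpha> - 1)) (at 0)"
    unfolding k_def using x by (auto intro!: derivative_eq_intros)
  have "((\<lambda>h. \<phi> (k h)) has_real_derivative partial_deriv L j v * (1 / \<alpha> * x $ j powr (1 / \<alpha> - 1))) (at 0)"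
    using DERIV_chain2[of \<phi> "partial_deriv L j v" k 0, OF _ d2] d1 by (simp add: k0)
  then have "((\<lambda>h. \<phi> (k h) powr \<alpha>) has_real_derivative
      \<alpha> * L v powr (\<alpha> - 1) * (partial_deriv L j v * (1 / \<alpha> * x $ j powr (1 / \<alpha> - 1)))) (at 0)"
  proof (rule DERIV_chain2[rotated])
    show "((\<lambda>z. z powr \<alpha>) has_real_derivative \<alpha> * L v powr (\<alpha> - 1)) (at (\<phi> (k 0)))"
    using Lv by (auto simp: k0 \<phi>_def intro!: has_real_derivative_powr)
  qed
  then show ?thesis
    using alpha by (simp add: attractor_partial_def attractor_stdf_def vec_powr_shift \<phi>_def k_def v_def mult_ac)
qed

lemma attractor_partial_continuous:
  assumes smooth: "has_continuous_partials L"
  shows "continuous_on {x. 0 \<le> x \<and> 0 < x $ j} (attractor_partial L \<alpha> j)"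
proof -
  let ?U = "{x :: real ^ 'n. 0 \<le> x \<and> 0 < x $ j}"
  let ?v = "\<lambda>x. vec_powr x (1 / \<alpha>)"
  have v: "continuous_on ?U ?v"
    unfolding vec_powr_def
    by (intro continuous_intros continuous_on_powr') (use alpha in \<open>auto simp: less_eq_vec_def\<close>)
  have vU: "?v ` ?U \<subseteq> ?U" by (auto simp: vec_powr_nonneg) (simp add: vec_powr_def)
  have pos: "0 < L (?v x)" if "x \<in> ?U" for x
    using that stdf_ge_component[OF L vec_powr_nonneg, of x "1 / \<alpha>" j]
        by (auto simp: vec_powr_def elim: less_le_trans[rotated])
  have Lc: "continuous_on ?U L"
    unfolding continuous_on_sequentially by (auto intro!: stdf_tendsto[OF L] simp: comp_def)
  have "continuous_on ?U (\<lambda>x. L (?v x))"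
    by (rule continuous_on_compose2[OF Lc v vU])
  moreover have "continuous_on ?U (\<lambda>x. partial_deriv L j (?v x))"
    by (rule continuous_on_compose2[OF _ v vU]) (use smooth in \<open>simp add: has_continuous_partials_def\<close>)
  ultimately show ?thesis
    unfolding attractor_partial_def
    by (intro continuous_intros) (use pos in \<open>auto simp: less_le\<close>)
qed

end

text \<open>
  A chain rule on the closed orthant. The function \<open>A\<close> need not be differentiable in a coordinate that
  vanishes, but there the directions \<open>q\<close> of interest vanish in the limit as well, and the Lipschitz bound
  disposes of that coordinate.
\<close>

context
  fixes A :: "real ^ 'n \<Rightarrow> real" and G :: "'n \<Rightarrow> real ^ 'n \<Rightarrow> real"
  assumes increment: "\<And>x h j. 0 \<le> x \<Longrightarrow> 0 \<le> h \<Longrightarrow> \<bar>A (x + h *\<^sub>R axis j 1) - A x\<bar> \<le> h"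
    and partial: "\<And>x j. 0 \<le> x \<Longrightarrow> 0 < x $ j \<Longrightarrow> ((\<lambda>h. A (x + h *\<^sub>R axis j 1)) has_real_derivative G j x) (at 0)"
    and partial_cont: "\<And>j. continuous_on {x. 0 \<le> x \<and> 0 < x $ j} (G j)"
begin

lemma coordinate_mean_value:
  assumes y: "0 \<le> y" and yj: "0 < y $ j" "0 < y $ j + d"
  shows "\<exists>\<theta>. \<bar>\<theta>\<bar> \<le> \<bar>d\<bar> \<and> 0 < y $ j + \<theta> \<and> A (y + d *\<^sub>R axis j 1) - A y = d * G j (y + \<theta> *\<^sub>R axis j 1)"
proof -
  define f where "f s = A (y + s *\<^sub>R axis j 1)" for s
  have der: "(f has_real_derivative G j (y + s *\<^sub>R axis j 1)) (at s)" if "0 < y $ j + s" for s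
  proof -
    have nn: "0 \<le> y + s *\<^sub>R axis j 1" "0 < (y + s *\<^sub>R axis j 1) $ j"
      using y that by (auto simp: less_eq_vec_def axis_def)
    have "((\<lambda>h. f (h + s)) has_real_derivative G j (y + s *\<^sub>R axis j 1)) (at 0)"
      using partial[OF nn] by (simp add: f_def algebra_simps)
    then show ?thesis using DERIV_shift[of f _ 0 s] by simp
  qed
  consider "d = 0" | "0 < d" | "d < 0" by linarith
  then show ?thesis
  proof cases
    case 1
    then show ?thesis using yj by (intro exI[of _ 0]) auto
  next
    case 2
    have "\<exists>z>0. z < d \<and> f d - f 0 = (d - 0) * G j (y + z *\<^sub>R axis j 1)"
      using 2 yj by (intro MVT2 der) auto
    then obtain z where "0 < z" "z < d" "f d - f 0 = (d - 0) * G j (y + z *\<^sub>R axis j 1)" by blast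
    then show ?thesis using yj by (intro exI[of _ z]) (auto simp: f_def)
  next
    case 3
    have "\<exists>z>d. z < 0 \<and> f 0 - f d = (0 - d) * G j (y + z *\<^sub>R axis j 1)"
      using 3 yj by (intro MVT2 der) auto
    then obtain z where "d < z" "z < 0" "f 0 - f d = (0 - d) * G j (y + z *\<^sub>R axis j 1)" by blast
    then show ?thesis using yj by (intro exI[of _ z]) (auto simp: f_def)
  qed
qed

text \<open>
  If the limit point has a positive \<open>j\<close>-th coordinate, the mean value theorem and continuity of the partial
  derivative apply; otherwise the quotient is at most \<open>\<bar>q n\<bar>\<close>, which tends to 0.
\<close>

lemma coordinate_difference_quotient:
  assumes y: "y \<longlonglongrightarrow> x0" "\<And>n. 0 \<le> y n" and e: "e \<longlonglongrightarrow> 0" "\<And>n. 0 < e n"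
    and q: "q \<longlonglongrightarrow> q0" "\<And>n. 0 \<le> y n + (e n * q n) *\<^sub>R axis j 1" and q0: "x0 $ j = 0 \<Longrightarrow> q0 = 0"
  shows "(\<lambda>n. (A (y n + (e n * q n) *\<^sub>R axis j 1) - A (y n)) / e n) \<longlonglongrightarrow> G j x0 * q0"
proof (cases "x0 $ j = 0")
  case True
  have "\<bar>A (y n + (e n * q n) *\<^sub>R axis j 1) - A (y n)\<bar> \<le> e n * \<bar>q n\<bar>" for n
  proof (cases "0 \<le> q n")
    case True
    then show ?thesis using increment[OF y(2)[of n], of "e n * q n" j] e(2)[of n] by simp
  next
    case False
    then have "0 \<le> - (e n * q n)" using e(2)[of n] by (simp add: mult_pos_neg less_imp_le)
    from increment[OF q(2)[of n] this, of j] show ?thesis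
      using False by (simp add: abs_minus_commute)
  qed
  then have "norm ((A (y n + (e n * q n) *\<^sub>R axis j 1) - A (y n)) / e n) \<le> \<bar>q n\<bar>" for n
    using e(2)[of n] by (simp add: abs_divide divide_simps mult.commute)
  moreover have "(\<lambda>n. \<bar>q n\<bar>) \<longlonglongrightarrow> 0" using tendsto_rabs[OF q(1)] q0[OF True] by simp
  ultimately have "(\<lambda>n. (A (y n + (e n * q n) *\<^sub>R axis j 1) - A (y n)) / e n) \<longlonglongrightarrow> 0"
    by (rule Lim_null_comparison[OF always_eventually[OF allI]])
  then show ?thesis using q0[OF True] by simp
next
  case False
  have x0: "0 \<le> x0" using y by (auto simp: less_eq_vec_def intro!: LIMSEQ_le_const[OF tendsto_vec_nth[OF y(1)]])
  then have x0j: "0 < x0 $ j" using False by (simp add: less_eq_vec_def less_le)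
  have d0: "(\<lambda>n. e n * q n) \<longlonglongrightarrow> 0" using tendsto_mult[OF e(1) q(1)] by simp
  have yj: "(\<lambda>n. y n $ j) \<longlonglongrightarrow> x0 $ j" by (intro tendsto_vec_nth y)
  have "\<forall>\<^sub>F n in sequentially. 0 < y n $ j" using order_tendstoD(1)[OF yj x0j] .
  moreover have "\<forall>\<^sub>F n in sequentially. 0 < y n $ j + e n * q n"
    using order_tendstoD(1)[OF tendsto_add[OF yj d0], of 0] x0j by simp
  ultimately have ev: "\<forall>\<^sub>F n in sequentially. \<exists>\<theta>. \<bar>\<theta>\<bar> \<le> \<bar>e n * q n\<bar> \<and> 0 < y n $ j + \<theta> \<and>
    A (y n + (e n * q n) *\<^sub>R axis j 1) - A (y n) = e n * q n * G j (y n + \<theta> *\<^sub>R axis j 1)"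
    by eventually_elim (rule coordinate_mean_value[OF y(2)])
  define \<theta> where "\<theta> n = (SOME \<theta>. \<bar>\<theta>\<bar> \<le> \<bar>e n * q n\<bar> \<and> 0 < y n $ j + \<theta> \<and>
    A (y n + (e n * q n) *\<^sub>R axis j 1) - A (y n) = e n * q n * G j (y n + \<theta> *\<^sub>R axis j 1))" for n
  have th: "\<forall>\<^sub>F n in sequentially. \<bar>\<theta> n\<bar> \<le> \<bar>e n * q n\<bar> \<and> 0 < y n $ j + \<theta> n \<and>
    A (y n + (e n * q n) *\<^sub>R axis j 1) - A (y n) = e n * q n * G j (y n + \<theta> n *\<^sub>R axis j 1)"
    using ev unfolding \<theta>_def by eventually_elim (rule someI_ex)
  have "\<theta> \<longlonglongrightarrow> 0"
    by (rule Lim_null_comparison[OF _ tendsto_rabs_zero[OF d0]]) (use th in \<open>auto elim: eventually_mono\<close>)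
  then have "(\<lambda>n. y n + \<theta> n *\<^sub>R axis j 1) \<longlonglongrightarrow> x0 + 0 *\<^sub>R axis j 1"
    by (intro tendsto_intros y)
  then have lim: "(\<lambda>n. y n + \<theta> n *\<^sub>R axis j 1) \<longlonglongrightarrow> x0" by simp
  have "\<forall>\<^sub>F n in sequentially. y n + \<theta> n *\<^sub>R axis j 1 \<in> {x. 0 \<le> x \<and> 0 < x $ j}"
    using th
  proof eventually_elim
    case (elim n)
    have "0 \<le> y n + \<theta> n *\<^sub>R axis j 1"
      using y(2)[of n] elim by (auto simp: less_eq_vec_def axis_def)
    then show ?case using elim by (simp add: axis_def)
  qed
  then have "(\<lambda>n. G j (y n + \<theta> n *\<^sub>R axis j 1)) \<longlonglongrightarrow> G j x0"
    using x0 x0j by (intro continuous_on_tendsto_compose[OF partial_cont lim]) auto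
  then have "(\<lambda>n. q n * G j (y n + \<theta> n *\<^sub>R axis j 1)) \<longlonglongrightarrow> q0 * G j x0" by (intro tendsto_mult q)
  moreover have "\<forall>\<^sub>F n in sequentially. q n * G j (y n + \<theta> n *\<^sub>R axis j 1)
      = (A (y n + (e n * q n) *\<^sub>R axis j 1) - A (y n)) / e n"
    using th by eventually_elim (use e(2) in \<open>simp add: less_le[of 0]\<close>)
  ultimately show ?thesis
    by (rule Lim_transform_eventually[THEN tendsto_eq_rhs]) simp
qed

text \<open>
  The point moves from \<open>x n\<close> to \<open>x n + e n * q n\<close> one coordinate at a time; all intermediate points have
  their coordinates from one of the two ends, so they stay in the orthant.
\<close>

lemma orthant_difference_quotient:
  assumes x: "x \<longlonglongrightarrow> x0" "\<And>n. 0 \<le> x n" and e: "e \<longlonglongrightarrow> 0" "\<And>n. 0 < e n"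
    and q: "q \<longlonglongrightarrow> q0" "\<And>n. 0 \<le> x n + e n *\<^sub>R q n" and q0: "\<And>j. x0 $ j = 0 \<Longrightarrow> q0 $ j = 0"
  shows "(\<lambda>n. (A (x n + e n *\<^sub>R q n) - A (x n)) / e n) \<longlonglongrightarrow> (\<Sum>j\<in>UNIV. G j x0 * q0 $ j)"
proof -
  define y where "y J n = (\<chi> j. if j \<in> J then (x n + e n *\<^sub>R q n) $ j else x n $ j)" for J n
  have y_nonneg: "0 \<le> y J n" for J n
    using x(2)[of n] q(2)[of n] by (auto simp: y_def less_eq_vec_def)
  have xq: "(\<lambda>n. x n + e n *\<^sub>R q n) \<longlonglongrightarrow> x0 + 0 *\<^sub>R q0" by (intro tendsto_intros x e q)
  have y_lim: "y J \<longlonglongrightarrow> x0" for J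
  proof (rule vec_tendstoI)
    fix i
    show "(\<lambda>n. y J n $ i) \<longlonglongrightarrow> x0 $ i"
      using tendsto_vec_nth[OF x(1), of i] tendsto_vec_nth[OF xq, of i]
      by (cases "i \<in> J") (simp_all add: y_def)
  qed
  have lim: "(\<lambda>n. (A (y J n) - A (x n)) / e n) \<longlonglongrightarrow> (\<Sum>j\<in>J. G j x0 * q0 $ j)" if "finite J" for J
    using that
  proof induction
    case empty
    have "y {} n = x n" for n by (simp add: y_def vec_eq_iff)
    then show ?case by simp
  next
    case (insert i J)
    have step: "y (insert i J) n = y J n + (e n * q n $ i) *\<^sub>R axis i 1" for n
      using insert.hyps by (auto simp: y_def vec_eq_iff axis_def)
    have "(\<lambda>n. (A (y J n + (e n * q n $ i) *\<^sub>R axis i 1) - A (y J n)) / e n) \<longlonglongrightarrow> G i x0 * q0 $ i"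
      by (intro coordinate_difference_quotient y_lim y_nonneg e tendsto_vec_nth q q0)
        (simp_all add: step[symmetric] y_nonneg)
    then have "(\<lambda>n. (A (y (insert i J) n) - A (y J n)) / e n + (A (y J n) - A (x n)) / e n) \<longlonglongrightarrow>
        G i x0 * q0 $ i + (\<Sum>j\<in>J. G j x0 * q0 $ j)"
      unfolding step by (intro tendsto_add insert.IH)
    then show ?case
      using insert.hyps by (simp add: add_divide_distrib[symmetric])
  qed
  have "y UNIV n = x n + e n *\<^sub>R q n" for n by (simp add: y_def vec_eq_iff)
  then show ?thesis using lim[OF finite_class.finite_UNIV] by simp
qed

end

section \<open>Expansion of an Archimax copula near the upper corner\<close>

text \<open>
  The second order limit for threshold exceedances up to a constant factor, with \<open>\<beta>
      = - \<rho> / \<alpha>\<close>: the first term is the second order error of the outer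
  generator, the sum is the effect of the second order errors of the inverse generators on \<open>L\<close>.
\<close>

definition second_order_profile :: "(real ^ 'n \<Rightarrow> real) \<Rightarrow> real \<Rightarrow> real \<Rightarrow> real ^ 'n \<Rightarrow> real" where
  "second_order_profile L \<alpha> \<beta> x = attractor_stdf L \<alpha> x powr (1 + \<beta>)
     - (\<Sum>j\<in>UNIV. attractor_partial L \<alpha> j x * x $ j powr (1 + \<beta>))"

context
  fixes L :: "real ^ 'n \<Rightarrow> real" and \<alpha> :: real
  assumes L: "stable_tail_dependence L" and alpha: "0 < \<alpha>" "\<alpha> \<le> 1" and smooth: "has_continuous_partials L"
begin

lemma attractor_difference_quotient:
  assumes x: "x \<longlonglongrightarrow> x0" "\<And>n. 0 \<le> x n" and e: "e \<longlonglongrightarrow> 0" "\<And>n. 0 < e n"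
    and q: "q \<longlonglongrightarrow> q0" "\<And>n. 0 \<le> x n + e n *\<^sub>R q n" and q0: "\<And>j. x0 $ j = 0 \<Longrightarrow> q0 $ j = 0"
  shows "(\<lambda>n. (attractor_stdf L \<alpha> (x n + e n *\<^sub>R q n) - attractor_stdf L \<alpha> (x n)) / e n)
    \<longlonglongrightarrow> (\<Sum>j\<in>UNIV. attractor_partial L \<alpha> j x0 * q0 $ j)"
proof (rule orthant_difference_quotient[OF _ _ _ assms])
  show "\<bar>attractor_stdf L \<alpha> (x + h *\<^sub>R axis j 1) - attractor_stdf L \<alpha> x\<bar> \<le> h" if "0 \<le> x" "0 \<le> h" for x h j
    using attractor_increment[OF L alpha that, of j] by simp
qed (use attractor_has_partial[OF L alpha smooth] attractor_partial_continuous[OF L alpha smooth] in auto)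

text \<open>
  Euler's identity for the homogeneous attractor, from its derivative in the direction \<open>1\<close>.
\<close>

lemma euler_at_one: "(\<Sum>j\<in>UNIV. attractor_partial L \<alpha> j 1) = attractor_stdf L \<alpha> 1"
proof -
  have one: "(0 :: real ^ 'n) \<le> 1" by (simp add: less_eq_vec_def)
  have "(\<lambda>n. (attractor_stdf L \<alpha> (1 + inverse (real (Suc n)) *\<^sub>R 1)
      - attractor_stdf L \<alpha> 1) / inverse (real (Suc n)))
      \<longlonglongrightarrow> (\<Sum>j\<in>UNIV. attractor_partial L \<alpha> j 1 * (1 :: real ^ 'n) $ j)"
    by (intro attractor_difference_quotient tendsto_const LIMSEQ_inverse_real_of_nat)
        (auto simp: less_eq_vec_def)
  moreover have "(attractor_stdf L \<alpha> (1 + inverse (real (Suc n)) *\<^sub>R 1)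
      - attractor_stdf L \<alpha> 1) / inverse (real (Suc n))
      = attractor_stdf L \<alpha> 1" for n
  proof -
    have "1 + inverse (real (Suc n)) *\<^sub>R 1 = (1 + inverse (real (Suc n))) *\<^sub>R (1 :: real ^ 'n)"
      by (simp add: scaleR_add_left)
    then show ?thesis
      using attractor_homogeneous[OF L alpha one, of "1 + inverse (real (Suc n))"]
      by (simp add: add_pos_nonneg field_simps)
  qed
  ultimately have "(\<lambda>n. attractor_stdf L \<alpha> 1) \<longlonglongrightarrow> (\<Sum>j\<in>UNIV. attractor_partial L \<alpha> j 1)" by simp
  then show ?thesis using LIMSEQ_unique[OF tendsto_const] by metis
qed

text \<open>
  Complete dependence at \<open>1\<close> is incompatible with smoothness: if the value were 1, the lower bound by the
  coordinates would force every partial derivative at \<open>1\<close> to be at least 1, so that Euler's identity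
  would give a value of at least the dimension.
\<close>

lemma attractor_one_gt_one:
  assumes dim: "CARD('n) \<ge> 2"
  shows "1 < attractor_stdf L \<alpha> 1"
proof (rule ccontr)
  have one: "(0 :: real ^ 'n) \<le> 1" by (simp add: less_eq_vec_def)
  assume "\<not> 1 < attractor_stdf L \<alpha> 1"
  then have A1: "attractor_stdf L \<alpha> 1 \<le> 1" by simp
  have "1 \<le> attractor_partial L \<alpha> j 1" for j
  proof (rule tendsto_lowerbound)
    show "((\<lambda>h. (attractor_stdf L \<alpha> (1 + h *\<^sub>R axis j 1)
        - attractor_stdf L \<alpha> 1) / h) \<longlongrightarrow> attractor_partial L \<alpha> j 1) (at_right 0)"
      using attractor_has_partial[OF L alpha smooth one, of j]
      by (simp add: has_field_derivative_iff filterlim_at_split)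
    have "1 \<le> (attractor_stdf L \<alpha> (1 + h *\<^sub>R axis j 1) - attractor_stdf L \<alpha> 1) / h" if "0 < h" for h
    proof -
      have "(1 + h *\<^sub>R axis j 1) $ j \<le> attractor_stdf L \<alpha> (1 + h *\<^sub>R axis j 1)"
        using that by (intro attractor_ge_component[OF L alpha]) (simp add: less_eq_vec_def axis_def)
      then show ?thesis using A1 that by (simp add: axis_def field_simps)
    qed
    then show "\<forall>\<^sub>F h in at_right 0. 1 \<le> (attractor_stdf L \<alpha> (1 + h *\<^sub>R axis j 1)
        - attractor_stdf L \<alpha> 1) / h"
      by (auto simp: eventually_at_right_field intro!: exI[of _ 1])
  qed simp
  then have "(\<Sum>j\<in>(UNIV :: 'n set). 1) \<le> (\<Sum>j\<in>UNIV. attractor_partial L \<alpha> j 1)"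
    by (intro sum_mono) auto
  with A1 dim show False by (simp add: euler_at_one)
qed

text \<open>
  The limit function is not null: with Euler's identity its value at \<open>1\<close> is
  \<open>a powr (1 + \<beta>) - a\<close>, where \<open>a > 1\<close> is the value of the attractor.
\<close>

lemma second_order_profile_one_pos:
  assumes dim: "CARD('n) \<ge> 2" and beta: "0 < \<beta>"
  shows "0 < second_order_profile L \<alpha> \<beta> 1"
proof -
  have "attractor_stdf L \<alpha> 1 powr 1 < attractor_stdf L \<alpha> 1 powr (1 + \<beta>)"
    using attractor_one_gt_one[OF dim] beta by (intro powr_less_mono) auto
  then show ?thesis
    using attractor_one_gt_one[OF dim] by (simp add: second_order_profile_def euler_at_one)
qed

text \<open>
  If \<open>\<kappa> (1 / \<zeta> n)\<close> is prescribed to first order, then so is \<open>\<zeta> n\<close>: monotonicity turns the pointwise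
  limit of \<open>s powr \<alpha> * \<kappa> (s / Z)\<close> into upper and lower bounds for \<open>s * \<zeta>\<close>. The set \<open>S\<close> confines
  monotonicity to where the generator is positive, since \<^const>\<open>kappa_b\<close> takes the default value 0
  elsewhere.
\<close>

lemma inverse_generator_limit:
  fixes \<kappa> :: "real \<Rightarrow> real"
  assumes lim: "\<And>Z. 0 \<le> Z \<Longrightarrow> (\<lambda>n. s n powr \<alpha> * \<kappa> (s n / Z)) \<longlonglongrightarrow> c * Z powr \<alpha>" and c: "0 < c"
    and mono: "\<And>y z. 0 \<le> y \<Longrightarrow> y \<le> z \<Longrightarrow> z \<in> S \<Longrightarrow> \<kappa> (1 / y) \<le> \<kappa> (1 / z)"
    and near: "\<forall>\<^sub>F y in at_right 0. y \<in> S"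
    and s: "filterlim s at_top sequentially" "\<And>n. 0 < s n"
    and x: "x \<longlonglongrightarrow> x0" "0 \<le> x0"
    and zeta: "\<And>n. 0 \<le> \<zeta> n" "\<And>n. \<zeta> n \<in> S" "\<And>n. s n powr \<alpha> * \<kappa> (1 / \<zeta> n) = x n"
  shows "(\<lambda>n. s n * \<zeta> n) \<longlonglongrightarrow> (x0 / c) powr (1 / \<alpha>)"
proof (rule order_tendstoI)
  define z0 where "z0 = (x0 / c) powr (1 / \<alpha>)"
  have z0: "0 \<le> z0" "c * z0 powr \<alpha> = x0" using x c alpha by (auto simp: z0_def powr_powr)
  fix Z assume Z: "(x0 / c) powr (1 / \<alpha>) < Z"
  then have "z0 < Z" by (simp add: z0_def)
  then have Z0: "0 < Z" "z0 < Z" using z0(1) by linarith+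
  have "z0 powr \<alpha> < Z powr \<alpha>" using z0 Z0 alpha by (intro powr_less_mono2) auto
  then have "x0 < c * Z powr \<alpha>" using z0(2) c by (metis mult_less_cancel_left_pos)
  then have "0 < c * Z powr \<alpha> - x0" by simp
  then have "\<forall>\<^sub>F n in sequentially. 0 < s n powr \<alpha> * \<kappa> (s n / Z) - x n"
    by (rule order_tendstoD(1)[OF tendsto_diff[OF lim x(1)], rotated]) (use Z0 in simp)
  then show "\<forall>\<^sub>F n in sequentially. s n * \<zeta> n < Z"
  proof eventually_elim
    case (elim n)
    show ?case
    proof (rule ccontr)
      assume "\<not> ?case"
      then have "Z / s n \<le> \<zeta> n" using s(2)[of n] by (simp add: field_simps)
      then have "\<kappa> (1 / (Z / s n)) \<le> \<kappa> (1 / \<zeta> n)"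
        using Z0 s(2)[of n] zeta by (intro mono) auto
      then have "s n powr \<alpha> * \<kappa> (s n / Z) \<le> s n powr \<alpha> * \<kappa> (1 / \<zeta> n)"
        by (intro mult_left_mono) auto
      then show False using elim zeta(3)[of n] by simp
    qed
  qed
next
  define z0 where "z0 = (x0 / c) powr (1 / \<alpha>)"
  have z0: "0 \<le> z0" "c * z0 powr \<alpha> = x0" using x c alpha by (auto simp: z0_def powr_powr)
  fix Z assume Z: "Z < (x0 / c) powr (1 / \<alpha>)"
  show "\<forall>\<^sub>F n in sequentially. Z < s n * \<zeta> n"
  proof (cases "0 \<le> Z")
    case False
    have "Z < s n * \<zeta> n" for n
    proof -
      have "0 \<le> s n * \<zeta> n" using s(2)[of n] zeta(1)[of n] by simp
      then show ?thesis using False by linarith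
    qed
    then show ?thesis by simp
  next
    case True
    \<comment> \<open>\<open>Z\<close> may be 0; a point strictly above it keeps \<open>Y / s n\<close> in the right neighbourhood of 0\<close>
    define Y where "Y = (Z + z0) / 2"
    have Y: "0 < Y" "Z < Y" "Y < z0" using True Z by (auto simp: Y_def z0_def)
    have "Y powr \<alpha> < z0 powr \<alpha>" using Y alpha by (intro powr_less_mono2) auto
    then have "c * Y powr \<alpha> < x0" using z0(2) c by (metis mult_less_cancel_left_pos)
    then have "0 < x0 - c * Y powr \<alpha>" by simp
    then have "\<forall>\<^sub>F n in sequentially. 0 < x n - s n powr \<alpha> * \<kappa> (s n / Y)"
      by (rule order_tendstoD(1)[OF tendsto_diff[OF x(1) lim], rotated]) (use Y in simp)
    moreover have "\<forall>\<^sub>F n in sequentially. Y / s n \<in> S"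
    proof -
      have "(\<lambda>n. Y / s n) \<longlonglongrightarrow> 0"
        by (rule real_tendsto_divide_at_top[OF tendsto_const s(1)])
      then have "filterlim (\<lambda>n. Y / s n) (at_right 0) sequentially"
        using Y s(2) less_imp_neq[THEN not_sym, OF s(2)]
            by (auto simp: filterlim_at intro!: always_eventually)
      then show ?thesis using near by (rule filterlim_iff[THEN iffD1, rule_format])
    qed
    ultimately show ?thesis
    proof eventually_elim
      case (elim n)
      show ?case
      proof (rule ccontr)
        assume "\<not> ?case"
        then have "\<zeta> n \<le> Y / s n" using s(2)[of n] Y by (simp add: field_simps)
        then have "\<kappa> (1 / \<zeta> n) \<le> \<kappa> (1 / (Y / s n))"
          using elim zeta by (intro mono) auto
        then have "s n powr \<alpha> * \<kappa> (1 / \<zeta> n) \<le> s n powr \<alpha> * \<kappa> (s n / Y)"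
          by (intro mult_left_mono) auto
        then show False using elim zeta(3)[of n] by simp
      qed
    qed
  qed
qed

text \<open>
  With \<open>z = s * \<zeta>\<close> and the error terms \<open>r\<close>, the equations that define \<open>\<zeta>\<close> say that
  \<open>c * z\<^sub>j powr \<alpha> = x\<^sub>j + B s * r\<^sub>j\<close>. By homogeneity \<open>c * L z powr \<alpha>\<close> is then the value of the attractor at the
  shifted point \<open>x + B s * r\<close>. So the error splits into a difference quotient of the attractor, to which
  the chain rule applies, and the second order error of \<open>\<kappa>\<close> at \<open>L z\<close>.
\<close>

lemma archimax_expansion:
  fixes \<kappa> B :: "real \<Rightarrow> real"
  assumes expn: "\<And>s z z0. filterlim s at_top sequentially \<Longrightarrow> z \<longlonglongrightarrow> z0 \<Longrightarrow> (\<And>n. 0 \<le> z n) \<Longrightarrow>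
      (\<lambda>n. (s n powr \<alpha> * \<kappa> (s n / z n) - c * z n powr \<alpha>) / B (s n)) \<longlonglongrightarrow> K * z0 powr (\<alpha> + p)"
    and c: "0 < c" and p: "0 < p"
    and B: "\<And>t. 0 < t \<Longrightarrow> 0 < B t" "(B \<longlongrightarrow> 0) at_top"
    and mono: "\<And>y z. 0 \<le> y \<Longrightarrow> y \<le> z \<Longrightarrow> z \<in> S \<Longrightarrow> \<kappa> (1 / y) \<le> \<kappa> (1 / z)"
    and near: "\<forall>\<^sub>F y in at_right 0. y \<in> S"
    and s: "filterlim s at_top sequentially" "\<And>n. 0 < s n"
    and x: "x \<longlonglongrightarrow> x0" "\<And>n. 0 \<le> x n"
    and zeta: "\<And>n. 0 \<le> \<zeta> n" "\<And>n j. \<zeta> n $ j \<in> S" "\<And>n j. s n powr \<alpha> * \<kappa> (1 / \<zeta> n $ j) = x n $ j"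
  shows "(\<lambda>n. (s n powr \<alpha> * \<kappa> (1 / L (\<zeta> n)) - attractor_stdf L \<alpha> (x n)) / B (s n))
      \<longlonglongrightarrow> K * c powr (- (1 + p / \<alpha>)) * second_order_profile L \<alpha> (p / \<alpha>) x0"
    and "(\<lambda>n. L (\<zeta> n)) \<longlonglongrightarrow> 0"
proof -
  have x0: "0 \<le> x0"
    using x by (auto simp: less_eq_vec_def intro!: LIMSEQ_le_const[OF tendsto_vec_nth[OF x(1)]])
  have Bs: "(\<lambda>n. B (s n)) \<longlonglongrightarrow> 0" "\<And>n. 0 < B (s n)"
    using filterlim_compose[OF B(2) s(1)] B(1) s(2) by auto
  have lead: "(\<lambda>n. s n powr \<alpha> * \<kappa> (s n / Z)) \<longlonglongrightarrow> c * Z powr \<alpha>" if "0 \<le> Z" for Z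
  proof -
    have "(\<lambda>n. (s n powr \<alpha> * \<kappa> (s n / Z) - c * Z powr \<alpha>) / B (s n) * B (s n) + c * Z powr \<alpha>)
        \<longlonglongrightarrow> K * Z powr (\<alpha> + p) * 0 + c * Z powr \<alpha>"
      using that by (intro tendsto_add tendsto_mult expn s Bs tendsto_const)
    then show ?thesis using Bs(2) by (simp add: less_imp_neq[THEN not_sym])
  qed
  define z0 where "z0 = (\<chi> j. (x0 $ j / c) powr (1 / \<alpha>))"
  define z where "z n = s n *\<^sub>R \<zeta> n" for n
  have z_nonneg: "0 \<le> z n" for n
    using zeta(1)[of n] s(2)[of n] by (simp add: z_def less_eq_vec_def)
  have z0_nonneg: "0 \<le> z0" by (simp add: z0_def less_eq_vec_def)
  have z_lim_nth: "(\<lambda>n. z n $ j) \<longlonglongrightarrow> z0 $ j" for j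
    unfolding z_def z0_def vector_scaleR_component vec_lambda_beta real_scaleR_def
    by (rule inverse_generator_limit[OF lead c mono near s tendsto_vec_nth[OF x(1)]])
      (use x0 zeta in \<open>auto simp: less_eq_vec_def\<close>)
  then have z_lim: "z \<longlonglongrightarrow> z0" by (rule vec_tendstoI)
  define r where "r n = (\<chi> j. - ((s n powr \<alpha> * \<kappa> (s n / z n $ j) - c * z n $ j powr \<alpha>) / B (s n)))" for n
  define r0 where "r0 = (\<chi> j. - (K * z0 $ j powr (\<alpha> + p)))"
  have r_lim: "r \<longlonglongrightarrow> r0"
    unfolding r_def r0_def
    by (intro tendsto_vec_lambda tendsto_minus expn s z_lim_nth)
        (use z_nonneg in \<open>simp add: less_eq_vec_def\<close>)
  have kz: "s n powr \<alpha> * \<kappa> (s n / z n $ j) = x n $ j" for n j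
    using zeta(3)[of n j] s(2)[of n] by (simp add: z_def)
  have shifted: "x n + B (s n) *\<^sub>R r n = (\<chi> j. c * z n $ j powr \<alpha>)" for n
    using Bs(2)[of n] by (simp add: vec_eq_iff r_def kz)
  have A_shifted: "attractor_stdf L \<alpha> (x n + B (s n) *\<^sub>R r n) = c * L (z n) powr \<alpha>" for n
  proof -
    have "vec_powr (\<chi> j. c * z n $ j powr \<alpha>) (1 / \<alpha>) = c powr (1 / \<alpha>) *\<^sub>R z n"
      using z_nonneg[of n] c alpha by (simp add: vec_powr_def vec_eq_iff powr_mult powr_powr less_eq_vec_def)
    then show ?thesis
      using c alpha z_nonneg[of n] stdf_nonneg[OF L z_nonneg[of n]]
      by (simp add: shifted attractor_stdf_def stdf_homogeneous[OF L] powr_mult powr_powr)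
  qed
  have Lz: "(\<lambda>n. L (z n)) \<longlonglongrightarrow> L z0"
    by (rule stdf_tendsto[OF L z_lim z_nonneg z0_nonneg])
  have Lz_zeta: "L (z n) = s n * L (\<zeta> n)" for n
    unfolding z_def by (rule stdf_homogeneous[OF L zeta(1) s(2)])
  have "(\<lambda>n. L (z n) / s n) \<longlonglongrightarrow> 0" by (rule real_tendsto_divide_at_top[OF Lz s(1)])
  then show "(\<lambda>n. L (\<zeta> n)) \<longlonglongrightarrow> 0"
    unfolding Lz_zeta using s(2) by (simp add: less_imp_neq[THEN not_sym])
  have "(\<lambda>n. (attractor_stdf L \<alpha> (x n + B (s n) *\<^sub>R r n) - attractor_stdf L \<alpha> (x n)) / B (s n))
      \<longlonglongrightarrow> (\<Sum>j\<in>UNIV. attractor_partial L \<alpha> j x0 * r0 $ j)"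
  proof (intro attractor_difference_quotient x Bs r_lim)
    show "0 \<le> x n + B (s n) *\<^sub>R r n" for n
      unfolding shifted using c by (simp add: less_eq_vec_def)
    show "r0 $ j = 0" if "x0 $ j = 0" for j
      using that by (simp add: r0_def z0_def)
  qed
  moreover have "(\<lambda>n. (s n powr \<alpha> * \<kappa> (s n / L (z n)) - c * L (z n) powr \<alpha>) / B (s n))
      \<longlonglongrightarrow> K * L z0 powr (\<alpha> + p)"
    by (rule expn[OF s(1) Lz stdf_nonneg[OF L z_nonneg]])
  ultimately have "(\<lambda>n. (attractor_stdf L \<alpha> (x n + B (s n) *\<^sub>R r n) - attractor_stdf L \<alpha> (x n)) / B (s n)
        + (s n powr \<alpha> * \<kappa> (s n / L (z n)) - c * L (z n) powr \<alpha>) / B (s n))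
      \<longlonglongrightarrow> (\<Sum>j\<in>UNIV. attractor_partial L \<alpha> j x0 * r0 $ j) + K * L z0 powr (\<alpha> + p)"
    by (rule tendsto_add)
  moreover have "(attractor_stdf L \<alpha> (x n + B (s n) *\<^sub>R r n) - attractor_stdf L \<alpha> (x n)) / B (s n)
        + (s n powr \<alpha> * \<kappa> (s n / L (z n)) - c * L (z n) powr \<alpha>) / B (s n)
      = (s n powr \<alpha> * \<kappa> (1 / L (\<zeta> n)) - attractor_stdf L \<alpha> (x n)) / B (s n)" for n
    using s(2)[of n] by (simp add: A_shifted Lz_zeta add_divide_distrib[symmetric])
  moreover have "(\<Sum>j\<in>UNIV. attractor_partial L \<alpha> j x0 * r0 $ j) + K * L z0 powr (\<alpha> + p)
      = K * c powr (- (1 + p / \<alpha>)) * second_order_profile L \<alpha> (p / \<alpha>) x0"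
  proof -
    have ex: "(1 / \<alpha>) * (\<alpha> + p) = 1 + p / \<alpha>" "\<alpha> * (1 + p / \<alpha>) = \<alpha> + p" using alpha
        by (simp_all add: field_simps)
    have comp: "z0 $ j powr (\<alpha> + p) = c powr (- (1 + p / \<alpha>)) * x0 $ j powr (1 + p / \<alpha>)" for j
    proof -
      have "z0 $ j powr (\<alpha> + p) = (x0 $ j / c) powr (1 + p / \<alpha>)"
        by (simp add: z0_def powr_powr ex del: times_divide_eq_left)
      then show ?thesis
        unfolding powr_minus_divide using x0 c by (simp add: powr_divide less_eq_vec_def)
    qed
    have "z0 = c powr (- (1 / \<alpha>)) *\<^sub>R vec_powr x0 (1 / \<alpha>)"
      using x0 c by (simp add: z0_def vec_powr_def vec_eq_iff powr_divide powr_minus_divide less_eq_vec_def)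
    then have "L z0 = c powr (- (1 / \<alpha>)) * L (vec_powr x0 (1 / \<alpha>))"
      using stdf_homogeneous[OF L vec_powr_nonneg] c by simp
    then have "L z0 powr (\<alpha> + p) = c powr (- (1 / \<alpha>) * (\<alpha> + p)) * L (vec_powr x0 (1 / \<alpha>)) powr (\<alpha> + p)"
      using stdf_nonneg[OF L vec_powr_nonneg, of x0 "1 / \<alpha>"]
          by (simp add: powr_mult powr_powr del: times_divide_eq_left)
    moreover have "- (1 / \<alpha>) * (\<alpha> + p) = - (1 + p / \<alpha>)" using ex(1) by linarith
    ultimately have "L z0 powr (\<alpha> + p) = c powr (- (1 + p / \<alpha>)) * attractor_stdf L \<alpha> x0 powr (1 + p / \<alpha>)"
      by (simp add: attractor_stdf_def powr_powr ex(2))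
    then show ?thesis
      by (simp add: second_order_profile_def r0_def comp sum_negf sum_distrib_left algebra_simps)
  qed
  ultimately show "(\<lambda>n. (s n powr \<alpha> * \<kappa> (1 / L (\<zeta> n)) - attractor_stdf L \<alpha> (x n)) / B (s n))
      \<longlonglongrightarrow> K * c powr (- (1 + p / \<alpha>)) * second_order_profile L \<alpha> (p / \<alpha>) x0"
    by simp
qed

end

section \<open>Archimedean generators\<close>

context
  fixes \<psi> :: "real \<Rightarrow> real" and d :: nat and \<alpha> :: real
  assumes psi: "archimedean_generator d \<psi>" and d: "2 \<le> d"
    and alpha: "0 < \<alpha>" and rv: "regularly_varying (kappa_p \<psi>) (- \<alpha>)"
begin

lemma generator_at_0: "\<psi> 0 = 1" and generator_range: "0 \<le> x \<Longrightarrow> 0 \<le> \<psi> x \<and> \<psi> x \<le> 1"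
  using psi by (auto simp: archimedean_generator_def)

text \<open>
  In dimension 2 the generator is only known to be convex, in higher dimensions it is differentiable.
\<close>

lemma generator_continuous_interior: "continuous_on {0<..} \<psi>"
proof (cases "d = 2")
  case True
  then have "convex_on {0<..} \<psi>"
    using psi by (simp add: archimedean_generator_def d_monotone_def)
  then show ?thesis by (rule convex_on_continuous[OF open_greaterThan])
next
  case False
  then have "0 < d - 2" using d by simp
  then have "\<psi> differentiable (at x)" if "0 < x" for x
    using psi that unfolding archimedean_generator_def d_monotone_def by (metis funpow_0)
  then show ?thesis
    by (intro continuous_at_imp_continuous_on) (auto intro: differentiable_imp_continuous_within)
qed

lemma generator_antimono:
  assumes xy: "0 \<le> x" "x \<le> y"
  shows "\<psi> y \<le> \<psi> x"
proof (cases "x = 0")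
  case True
  then show ?thesis using generator_at_0 generator_range[of y] xy by simp
next
  case False
  with xy have x: "0 < x" by simp
  show ?thesis
  proof (cases "d = 2")
    case True
    then have "antimono_on {0<..} \<psi>"
      using psi by (simp add: archimedean_generator_def d_monotone_def)
    then show ?thesis using x xy by (auto simp: monotone_on_def)
  next
    case False
    then have d3: "0 < d - 2" "1 \<le> d - 2" using d by simp_all
    have mono: "d_monotone d \<psi>" using psi by (simp add: archimedean_generator_def)
    have "\<exists>y. (\<psi> has_real_derivative y) (at t) \<and> y \<le> 0" if "0 < t" for t
    proof -
      have "\<psi> differentiable (at t)"
        using mono d3 that unfolding d_monotone_def by (metis funpow_0)
      then have "(\<psi> has_real_derivative deriv \<psi> t) (at t)"
        by (rule DERIV_deriv_iff_real_differentiable[THEN iffD2])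
      moreover have "0 \<le> (- 1) ^ 1 * (deriv ^^ 1) \<psi> t"
        using mono d3 that unfolding d_monotone_def by blast
      ultimately show ?thesis by auto
    qed
    with x show ?thesis by (intro DERIV_nonpos_imp_nonincreasing[OF xy(2)]) (meson less_le_trans)
  qed
qed

text \<open>
  The definition of a generator does not exclude a jump at 0, regular variation with a negative index
  does: the decreasing sequence \<open>kappa_p \<psi> (2 ^ n)\<close> has a limit \<open>l\<close> with \<open>l = 2 powr (- \<alpha>) * l\<close>.
\<close>

lemma generator_tendsto_one: "(\<psi> \<longlongrightarrow> 1) (at_right 0)"
proof -
  define X where "X n = kappa_p \<psi> (2 ^ n)" for n :: nat
  have Xpos: "0 < X n" for n using rv by (simp add: X_def regularly_varying_def)
  have "decseq X"
  proof (rule decseq_SucI)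
    show "X (Suc n) \<le> X n" for n
      using generator_antimono[of "1 / 2 ^ Suc n" "1 / 2 ^ n"]
      by (simp add: X_def kappa_p_def divide_simps)
  qed
  then obtain l where l: "X \<longlonglongrightarrow> l"
    by (rule decseq_convergent[of X 0]) (use Xpos in \<open>simp add: less_imp_le\<close>)
  have "filterlim (\<lambda>n. norm ((2 :: real) ^ n)) at_top sequentially"
    by (intro filterlim_at_infinity_imp_norm_at_top filterlim_realpow_sequentially_gt1) simp
  then have pow: "filterlim (\<lambda>n. (2 :: real) ^ n) at_top sequentially" by simp
  have "((\<lambda>t. kappa_p \<psi> (t * 2) / kappa_p \<psi> t) \<longlongrightarrow> 2 powr (- \<alpha>)) at_top"
    using rv by (simp add: regularly_varying_def)
  from filterlim_compose[OF this pow]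
  have "(\<lambda>n. kappa_p \<psi> (2 ^ n * 2) / kappa_p \<psi> (2 ^ n)) \<longlonglongrightarrow> 2 powr (- \<alpha>)" .
  then have "(\<lambda>n. X (Suc n) / X n) \<longlonglongrightarrow> 2 powr (- \<alpha>)" by (simp add: X_def mult.commute)
  from tendsto_mult[OF this l] have "(\<lambda>n. X (Suc n)) \<longlonglongrightarrow> 2 powr (- \<alpha>) * l"
    using Xpos by (simp add: less_imp_neq[THEN not_sym])
  with LIMSEQ_Suc[OF l] have "l = 2 powr (- \<alpha>) * l" by (rule LIMSEQ_unique)
  moreover have "2 powr (- \<alpha>) < 1" using alpha by (simp add: powr_less_one)
  ultimately have "l = 0" by auto
  show ?thesis
  proof (rule tendstoI)
    fix e :: real assume e: "0 < e"
    have "\<forall>\<^sub>F n in sequentially. X n < e" using l \<open>l = 0\<close> e by (intro order_tendstoD) auto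
    then obtain n where n: "X n < e" by (auto dest: eventually_happens)
    have "dist (\<psi> y) 1 < e" if "0 < y" "y < 1 / 2 ^ n" for y
      using generator_antimono[of y "1 / 2 ^ n"] generator_range[of y] that n
      by (simp add: X_def kappa_p_def dist_real_def)
    then show "\<forall>\<^sub>F y in at_right 0. dist (\<psi> y) 1 < e"
      unfolding eventually_at_right_field by (intro exI[of _ "1 / 2 ^ n"]) auto
  qed
qed

lemma generator_continuous: "continuous_on {0..} \<psi>"
  unfolding continuous_on_eq_continuous_within
proof
  fix x :: real assume "x \<in> {0..}"
  then consider "x = 0" | "0 < x" by fastforce
  then show "continuous (at x within {0..}) \<psi>"
  proof cases
    case 1
    have "(\<psi> \<longlongrightarrow> \<psi> 0) (at_right 0)" using generator_tendsto_one generator_at_0 by simp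
    then show ?thesis using 1 by (simp add: continuous_within at_within_Ici_at_right)
  next
    case 2
    then show ?thesis
      using generator_continuous_interior
      by (auto simp: continuous_on_eq_continuous_at intro: continuous_at_imp_continuous_within)
  qed
qed

lemma generator_pos_near_0: "\<forall>\<^sub>F y in at_right 0. 0 < \<psi> y"
  using order_tendstoD(1)[OF generator_tendsto_one] by simp

text \<open>
  Strict monotonicity is available up to the first zero of \<open>\<psi>\<close>, and every point with \<open>\<psi> > 0\<close> lies below
  all zeros.
\<close>

lemma generator_unique:
  assumes "0 \<le> x" "0 \<le> y" "\<psi> x = \<psi> y" "0 < \<psi> y"
  shows "x = y"
proof -
  have below: "ereal z \<le> gen_zero \<psi>" if "0 < \<psi> z" "0 \<le> z" for z
    unfolding gen_zero_def
  proof (rule Inf_greatest)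
    fix w' assume "w' \<in> ereal ` {x. 0 \<le> x \<and> \<psi> x = 0}"
    then obtain w where w: "w' = ereal w" "0 \<le> w" "\<psi> w = 0" by auto
    have "z \<le> w"
      using generator_antimono[of w z] w that by (cases "z \<le> w") auto
    then show "ereal z \<le> w'" using w by simp
  qed
  have strict: "\<psi> b < \<psi> a" if "0 \<le> a" "a < b" "0 < \<psi> a" "0 < \<psi> b" for a b
    using psi below[of a] below[of b] that by (auto simp: archimedean_generator_def monotone_on_def)
  show ?thesis using strict[of x y] strict[of y x] assms by (cases x y rule: linorder_cases) auto
qed

lemma gen_inv_interior:
  assumes u: "0 < u" "u \<le> 1"
  obtains x where "0 \<le> x" "\<psi> x = u" "gen_inv \<psi> u = ereal x"
proof -
  have "(\<psi> \<longlongrightarrow> 0) at_top" using psi by (simp add: archimedean_generator_def)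
  then have "\<forall>\<^sub>F x in at_top. \<psi> x < u" by (rule order_tendstoD(2)[OF _ u(1)])
  then obtain b where b: "0 \<le> b" "\<psi> b < u"
    using eventually_happens'[OF _ eventually_conj[OF _ eventually_ge_at_top[of 0]]] by auto
  have "\<exists>x\<ge>0. x \<le> b \<and> \<psi> x = u"
    by (rule IVT2') (use b u generator_at_0 in \<open>auto intro: continuous_on_subset[OF generator_continuous]\<close>)
  then obtain x where x: "0 \<le> x" "\<psi> x = u" by blast
  then have "(THE x. 0 \<le> x \<and> \<psi> x = u) = x"
    using u by (intro the_equality) (auto intro: generator_unique)
  with x u that show thesis by (simp add: gen_inv_def)
qed

lemma gen_inv_nonneg:
  assumes u: "0 \<le> u" "u \<le> 1"
  shows "0 \<le> gen_inv \<psi> u"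
proof (cases "u = 0")
  case True
  then show ?thesis by (auto simp: gen_inv_def gen_zero_def intro!: Inf_greatest)
next
  case False
  then show ?thesis using gen_inv_interior[of u] u by (metis ereal_less_eq(5) order_le_less)
qed

lemma generator_gen_zero:
  assumes "gen_zero \<psi> \<noteq> \<infinity>"
  shows "\<psi> (real_of_ereal (gen_zero \<psi>)) = 0"
proof -
  let ?Z = "{x \<in> {0..}. \<psi> x = 0}"
  have Z: "gen_zero \<psi> = Inf (ereal ` ?Z)" by (simp add: gen_zero_def)
  have ne: "?Z \<noteq> {}"
  proof
    assume empty: "?Z = {}"
    show False using assms unfolding Z empty by (simp add: top_ereal_def)
  qed
  have bdd: "bdd_below ?Z" by (auto intro!: bdd_belowI[of _ 0])
  have "closed ?Z"
    by (rule continuous_closed_preimage_constant[OF generator_continuous closed_atLeast])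
  then have "Inf ?Z \<in> ?Z" by (rule closed_contains_Inf[OF ne bdd])
  moreover have "gen_zero \<psi> = ereal (Inf ?Z)" unfolding Z by (rule ereal_Inf'[OF bdd ne, symmetric])
  ultimately show ?thesis by simp
qed

lemma archimax_interior:
  fixes u :: "real ^ 'n"
  assumes u: "\<And>j. 0 < u $ j" "\<And>j. u $ j \<le> 1"
  obtains \<zeta> where "0 \<le> \<zeta>" "\<And>j. \<psi> (\<zeta> $ j) = u $ j" "archimax \<psi> L u = \<psi> (L \<zeta>)"
proof -
  have "\<exists>x. 0 \<le> x \<and> \<psi> x = u $ j \<and> gen_inv \<psi> (u $ j) = ereal x" for j
    using gen_inv_interior[OF u] by metis
  then obtain z where z: "\<And>j. 0 \<le> z j" "\<And>j. \<psi> (z j) = u $ j" "\<And>j. gen_inv \<psi> (u $ j) = ereal (z j)"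
    by metis
  then show thesis
    by (intro that[of "\<chi> j. z j"]) (auto simp: less_eq_vec_def archimax_def)
qed

text \<open>
  If the inverse generator is finite at 0, it is a zero of \<open>\<psi>\<close>, and \<open>L\<close> maps beyond that zero.
\<close>

lemma archimax_zero:
  fixes u :: "real ^ 'n"
  assumes u: "u \<in> {0..1}" "u $ i = 0" and L: "\<And>x j. 0 \<le> x \<Longrightarrow> x $ j \<le> L x"
  shows "archimax \<psi> L u = 0"
proof (cases "\<exists>j. gen_inv \<psi> (u $ j) = \<infinity>")
  case False
  define z where "z = (\<chi> j. real_of_ereal (gen_inv \<psi> (u $ j)))"
  have z: "0 \<le> z"
    using u gen_inv_nonneg by (auto simp: z_def less_eq_vec_def real_of_ereal_pos)
  have zi: "\<psi> (z $ i) = 0"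
  proof -
    have inv: "gen_inv \<psi> (u $ i) = gen_zero \<psi>" by (simp add: gen_inv_def u(2))
    then have "gen_zero \<psi> \<noteq> \<infinity>" using False by metis
    then show ?thesis using generator_gen_zero inv by (simp add: z_def)
  qed
  have "\<psi> (L z) \<le> \<psi> (z $ i)"
    using z by (intro generator_antimono L) (auto simp: less_eq_vec_def)
  moreover have "0 \<le> z $ i" using z by (simp add: less_eq_vec_def)
  then have "0 \<le> L z" using L[OF z, of i] by linarith
  ultimately have "\<psi> (L z) = 0" using generator_range[of "L z"] zi by simp
  then show ?thesis using False by (simp add: archimax_def z_def)
qed (simp add: archimax_def)

end

section \<open>Rates of convergence for threshold exceedances and block maxima\<close>

lemma second_order_tailI:
  assumes so: "second_order_rv \<kappa> \<alpha> B h" and par: "second_order_param \<alpha> h \<rho>" and rho: "\<rho> < 0"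
    and alpha: "0 < \<alpha>" and w0: "0 < w0" "\<And>w. w0 \<le> w \<Longrightarrow> 0 < \<kappa> w" "continuous_on {w0..} \<kappa>"
  obtains \<gamma> where "second_order_tail \<kappa> B \<alpha> \<rho> \<gamma> w0"
proof -
  obtain \<gamma> where \<gamma>: "\<gamma> \<noteq> 0" "\<And>x. 0 < x \<Longrightarrow> h x = \<gamma> * x powr (- \<alpha>) * ((x powr \<rho> - 1) / \<rho>)"
    using par rho unfolding second_order_param_def by auto
  have "second_order_tail \<kappa> B \<alpha> \<rho> \<gamma> w0"
  proof
    fix x :: real assume x: "0 < x"
    have "((\<lambda>t. (\<kappa> (t * x) / \<kappa> t - x powr (- \<alpha>)) / B t) \<longlongrightarrow> h x) at_top"
      using so x by (simp add: second_order_rv_def)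
    then show "((\<lambda>t. (\<kappa> (t * x) / \<kappa> t - x powr (- \<alpha>)) / B t) \<longlongrightarrow> \<gamma> * x powr (- \<alpha>) * ((x powr \<rho>
        - 1) / \<rho>)) at_top"
      by (simp add: \<gamma>(2)[OF x])
  qed (use so rho alpha w0 \<gamma>(1) in \<open>auto simp: second_order_rv_def\<close>)
  then show thesis by (rule that)
qed

context second_order_tail
begin

lemma root_at_top: "filterlim (\<lambda>t. t powr (1 / \<alpha>)) at_top (at_top :: real filter)"
proof -
  have "filterlim (\<lambda>t. exp (1 / \<alpha> * ln t)) at_top (at_top :: real filter)"
    by (rule filterlim_compose[OF exp_at_top filterlim_tendsto_pos_mult_at_top[OF tendsto_const _ ln_at_top]])
      (use alpha in simp)
  moreover have "\<forall>\<^sub>F t :: real in at_top. exp (1 / \<alpha> * ln t) = t powr (1 / \<alpha>)"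
    using eventually_gt_at_top[of 0] by eventually_elim (simp add: powr_def)
  ultimately show ?thesis by (simp cong: filterlim_cong)
qed

lemma rate_tendsto_zero: "((\<lambda>t. B (t powr (1 / \<alpha>))) \<longlongrightarrow> 0) at_top"
  by (rule filterlim_compose[OF B_lim root_at_top])

lemma rate_regularly_varying: "regularly_varying (\<lambda>t. B (t powr (1 / \<alpha>))) (\<rho> / \<alpha>)"
  unfolding regularly_varying_def
proof (intro conjI allI impI)
  fix x :: real assume x: "0 < x"
  have "((\<lambda>t. B (t powr (1 / \<alpha>) * x powr (1 / \<alpha>)) / B (t powr (1 / \<alpha>))) \<longlongrightarrow> (x powr (1 / \<alpha>)) powr \<rho>) at_top"
    by (rule filterlim_compose[OF B_regularly_varying root_at_top]) (use x in simp)
  moreover have "\<forall>\<^sub>F t in at_top. B (t powr (1 / \<alpha>) * x powr (1 / \<alpha>)) / B (t powr (1 / \<alpha>))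
      = B ((t * x) powr (1 / \<alpha>)) / B (t powr (1 / \<alpha>))"
    using eventually_gt_at_top[of 0] by eventually_elim (use x in \<open>simp add: powr_mult\<close>)
  ultimately show "((\<lambda>t. B ((t * x) powr (1 / \<alpha>)) / B (t powr (1 / \<alpha>))) \<longlongrightarrow> x powr (\<rho> / \<alpha>)) at_top"
    by (rule Lim_transform_eventually[THEN tendsto_eq_rhs]) (simp add: powr_powr)
qed (use B_pos in auto)

text \<open>
  The expansion in terms of \<open>t = s powr \<alpha>\<close>, for both tail functions: \<open>S\<close> is the whole line for
  \<^const>\<open>kappa_p\<close> and the set where the generator is positive for \<^const>\<open>kappa_b\<close>.
\<close>

lemma archimax_second_order:
  fixes L :: "real ^ 'n \<Rightarrow> real"
  assumes L: "stable_tail_dependence L" and smooth: "has_continuous_partials L" and alpha1: "\<alpha> \<le> 1"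
    and kappa_0: "\<kappa> 0 = 0"
    and mono: "\<And>y z. 0 \<le> y \<Longrightarrow> y \<le> z \<Longrightarrow> z \<in> S \<Longrightarrow> \<kappa> (1 / y) \<le> \<kappa> (1 / z)"
    and near: "\<forall>\<^sub>F y in at_right 0. y \<in> S"
  obtains K where "K \<noteq> 0"
    "\<And>t x x0 \<zeta>. filterlim t at_top sequentially \<Longrightarrow> (\<And>n. 0 < t n) \<Longrightarrow> x \<longlonglongrightarrow> x0 \<Longrightarrow> (\<And>n. 0 \<le> x n) \<Longrightarrow>
      (\<And>n. 0 \<le> \<zeta> n) \<Longrightarrow> (\<And>n j. \<zeta> n $ j \<in> S) \<Longrightarrow> (\<And>n j. t n * \<kappa> (1 / \<zeta> n $ j) = x n $ j) \<Longrightarrow>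
      (\<lambda>n. (t n * \<kappa> (1 / L (\<zeta> n)) - attractor_stdf L \<alpha> (x n)) / B (t n powr (1 / \<alpha>)))
        \<longlonglongrightarrow> K * second_order_profile L \<alpha> (- \<rho> / \<alpha>) x0"
    "\<And>t x x0 \<zeta>. filterlim t at_top sequentially \<Longrightarrow> (\<And>n. 0 < t n) \<Longrightarrow> x \<longlonglongrightarrow> x0 \<Longrightarrow> (\<And>n. 0 \<le> x n) \<Longrightarrow>
      (\<And>n. 0 \<le> \<zeta> n) \<Longrightarrow> (\<And>n j. \<zeta> n $ j \<in> S) \<Longrightarrow> (\<And>n j. t n * \<kappa> (1 / \<zeta> n $ j) = x n $ j) \<Longrightarrow>
      (\<lambda>n. L (\<zeta> n)) \<longlonglongrightarrow> 0"
proof -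
  obtain c where c: "0 < c" and ex: "\<And>s z z0. filterlim s at_top sequentially \<Longrightarrow> z \<longlonglongrightarrow> z0 \<Longrightarrow> (\<And>n. 0 \<le> z n) \<Longrightarrow>
    (\<lambda>n. (s n powr \<alpha> * \<kappa> (s n / z n) - c * z n powr \<alpha>) / B (s n)) \<longlonglongrightarrow> c * (\<gamma> / \<rho>) * z0 powr (\<alpha> - \<rho>)"
    using second_order_expansion[OF kappa_0] by blast
  have ex': "(\<lambda>n. (s n powr \<alpha> * \<kappa> (s n / z n) - c * z n powr \<alpha>) / B (s n))
      \<longlonglongrightarrow> c * (\<gamma> / \<rho>) * z0 powr (\<alpha> + - \<rho>)"
    if "filterlim s at_top sequentially" "z \<longlonglongrightarrow> z0" "\<And>n. 0 \<le> z n" for s z z0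
    using ex[OF that] by simp
  have p: "0 < - \<rho>" using rho by simp
  note expansion = archimax_expansion[OF L alpha alpha1 smooth, where B = B and S = S]
  show thesis
  proof (rule that)
    show "c * (\<gamma> / \<rho>) * c powr (- (1 + - \<rho> / \<alpha>)) \<noteq> 0" using c gamma rho by simp
    fix t :: "nat \<Rightarrow> real" and x \<zeta> :: "nat \<Rightarrow> real ^ 'n" and x0
    assume t: "filterlim t at_top sequentially" "\<And>n. 0 < t n" and x: "x \<longlonglongrightarrow> x0" "\<And>n. 0 \<le> x n"
      and z: "\<And>n. 0 \<le> \<zeta> n" "\<And>n j. \<zeta> n $ j \<in> S" "\<And>n j. t n * \<kappa> (1 / \<zeta> n $ j) = x n $ j"
    have s: "filterlim (\<lambda>n. t n powr (1 / \<alpha>)) at_top sequentially" "0 < t n powr (1 / \<alpha>)" for n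
      using filterlim_compose[OF root_at_top t(1)] t(2)[of n] by auto
    have pw: "(t n powr (1 / \<alpha>)) powr \<alpha> = t n" for n
      using t(2)[of n] alpha by (simp add: powr_powr)
    show "(\<lambda>n. (t n * \<kappa> (1 / L (\<zeta> n)) - attractor_stdf L \<alpha> (x n)) / B (t n powr (1 / \<alpha>)))
        \<longlonglongrightarrow> c * (\<gamma> / \<rho>) * c powr (- (1 + - \<rho> / \<alpha>)) * second_order_profile L \<alpha> (- \<rho> / \<alpha>) x0"
      by (rule expansion(1)[where s = "\<lambda>n. t n powr (1 / \<alpha>)" and \<zeta> = \<zeta>, unfolded pw])
        (fact ex' c p B_pos B_lim mono near s x z)+
    show "(\<lambda>n. L (\<zeta> n)) \<longlonglongrightarrow> 0"
      by (rule expansion(2)[where s = "\<lambda>n. t n powr (1 / \<alpha>)" and \<zeta> = \<zeta> and x = x, unfolded pw])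
        (fact ex' c p B_pos B_lim mono near s x z)+
  qed
qed

end

context
  fixes L :: "real ^ 'n \<Rightarrow> real" and \<psi> :: "real \<Rightarrow> real" and \<alpha> :: real
  assumes dim: "CARD('n) \<ge> 2" and L: "stable_tail_dependence L"
    and psi: "archimedean_generator CARD('n) \<psi>" and index: "0 < \<alpha>" "\<alpha> \<le> 1"
    and rv: "regularly_varying (kappa_p \<psi>) (- \<alpha>)" and smooth: "has_continuous_partials L"
begin

text \<open>
  At \<open>1 - x / t\<close> the inverse generators \<open>\<zeta>\<close> satisfy \<open>t * kappa_p \<psi> (1 / \<zeta>\<^sub>j) = x\<^sub>j\<close> exactly.
\<close>

lemma POT_rate:
  assumes so: "second_order_rv (kappa_p \<psi>) \<alpha> B h" and par: "second_order_param \<alpha> h \<rho>" and rho: "\<rho> < 0"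
  shows "\<exists>S. POT_second_order (archimax \<psi> L) (attractor_stdf L \<alpha>) (\<lambda>t. B (t powr (1 / \<alpha>))) S"
    and "regularly_varying (\<lambda>t. B (t powr (1 / \<alpha>))) (\<rho> / \<alpha>)"
proof -
  note gen = psi dim index(1) rv
  have kappa_pos: "0 < kappa_p \<psi> w" if "1 \<le> w" for w
    using rv that by (simp add: regularly_varying_def)
  have kappa_cont: "continuous_on {1..} (kappa_p \<psi>)"
    unfolding kappa_p_def
    by (intro continuous_intros continuous_on_compose2[OF generator_continuous[OF gen]]) auto
  obtain \<gamma> where "second_order_tail (kappa_p \<psi>) B \<alpha> \<rho> \<gamma> 1"
    using second_order_tailI[OF so par rho index(1) _ kappa_pos kappa_cont] by auto
  then interpret second_order_tail "kappa_p \<psi>" B \<alpha> \<rho> \<gamma> 1 .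
  show "regularly_varying (\<lambda>t. B (t powr (1 / \<alpha>))) (\<rho> / \<alpha>)" by (rule rate_regularly_varying)
  have kappa_0: "kappa_p \<psi> 0 = 0" by (simp add: kappa_p_def generator_at_0[OF gen])
  have mono: "kappa_p \<psi> (1 / y) \<le> kappa_p \<psi> (1 / z)" if "0 \<le> y" "y \<le> z" for y z
    using generator_antimono[OF gen that] by (simp add: kappa_p_def)
  obtain K where K: "K \<noteq> 0" and lim: "\<And>t x x0 \<zeta>. filterlim t at_top sequentially \<Longrightarrow> (\<And>n. 0 < t n) \<Longrightarrow> x \<longlonglongrightarrow> x0 \<Longrightarrow>
      (\<And>n. 0 \<le> x n) \<Longrightarrow> (\<And>n. 0 \<le> \<zeta> n) \<Longrightarrow> (\<And>n j. t n * kappa_p \<psi> (1 / \<zeta> n $ j) = x n $ j) \<Longrightarrow>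
      (\<lambda>n. (t n * kappa_p \<psi> (1 / L (\<zeta> n)) - attractor_stdf L \<alpha> (x n)) / B (t n powr (1 / \<alpha>)))
        \<longlonglongrightarrow> K * second_order_profile L \<alpha> (- \<rho> / \<alpha>) x0"
  proof (rule archimax_second_order[OF L smooth index(2) kappa_0, of UNIV])
  qed (use mono in auto)
  have "uniform_limit {0..vec T} (\<lambda>t x. (t * (1 - archimax \<psi> L (1 - x /\<^sub>R t))
      - attractor_stdf L \<alpha> x) / B (t powr (1 / \<alpha>)))
      (\<lambda>x. K * second_order_profile L \<alpha> (- \<rho> / \<alpha>) x) at_top" if T: "0 < T" for T
  proof (rule uniform_limit_compactI[of _ "T + 1"])
    show "compact {0 .. vec T :: real ^ 'n}" by (simp add: interval_cbox_cart[symmetric])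
    fix t :: "nat \<Rightarrow> real" and x :: "nat \<Rightarrow> real ^ 'n" and x0
    assume tT: "\<And>n. T + 1 \<le> t n" and t: "filterlim t at_top sequentially"
      and xK: "\<And>n. x n \<in> {0..vec T}" and x: "x \<longlonglongrightarrow> x0"
    have tpos: "0 < t n" for n using tT[of n] T by linarith
    have xn: "0 \<le> x n $ j" "x n $ j \<le> T" for n j using xK[of n] by (auto simp: less_eq_vec_def)
    have "\<exists>z. 0 \<le> z \<and> (\<forall>j. \<psi> (z $ j) = (1 - x n /\<^sub>R t n) $ j) \<and> archimax \<psi> L (1 - x n /\<^sub>R t n)
        = \<psi> (L z)" for n
    proof -
      have "0 < (1 - x n /\<^sub>R t n) $ j" "(1 - x n /\<^sub>R t n) $ j \<le> 1" for j
        using xn[of n j] tT[of n] tpos[of n] by (auto simp: field_simps)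
      then show ?thesis using archimax_interior[OF gen] by metis
    qed
    then obtain \<zeta> where z: "\<And>n. 0 \<le> \<zeta> n" "\<And>n j. \<psi> (\<zeta> n $ j) = (1 - x n /\<^sub>R t n) $ j"
      "\<And>n. archimax \<psi> L (1 - x n /\<^sub>R t n) = \<psi> (L (\<zeta> n))" by metis
    have "(\<lambda>n. (t n * kappa_p \<psi> (1 / L (\<zeta> n)) - attractor_stdf L \<alpha> (x n)) / B (t n powr (1 / \<alpha>)))
        \<longlonglongrightarrow> K * second_order_profile L \<alpha> (- \<rho> / \<alpha>) x0"
    proof (rule lim[OF t tpos x _ z(1)])
      show "0 \<le> x n" for n using xK[of n] by simp
      show "t n * kappa_p \<psi> (1 / \<zeta> n $ j) = x n $ j" for n j
        using tpos[of n] by (simp add: kappa_p_def z(2))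
    qed
    then show "(\<lambda>n. (t n * (1 - archimax \<psi> L (1 - x n /\<^sub>R t n))
        - attractor_stdf L \<alpha> (x n)) / B (t n powr (1 / \<alpha>)))
        \<longlonglongrightarrow> K * second_order_profile L \<alpha> (- \<rho> / \<alpha>) x0"
      by (simp add: kappa_p_def z(3))
  qed
  moreover have "\<exists>x\<ge>0. K * second_order_profile L \<alpha> (- \<rho> / \<alpha>) x \<noteq> 0"
    using second_order_profile_one_pos[OF L index smooth dim, of "- \<rho> / \<alpha>"] K rho index
    by (intro exI[of _ 1]) (auto simp: less_eq_vec_def divide_neg_pos)
  ultimately have "POT_second_order (archimax \<psi> L) (attractor_stdf L \<alpha>) (\<lambda>t. B (t powr (1 / \<alpha>)))
      (\<lambda>x. K * second_order_profile L \<alpha> (- \<rho> / \<alpha>) x)"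
    unfolding POT_second_order_def using B_pos rate_tendsto_zero by auto
  then show "\<exists>S. POT_second_order (archimax \<psi> L) (attractor_stdf L \<alpha>) (\<lambda>t. B (t powr (1 / \<alpha>))) S" by blast
qed

lemma attractor_tendsto:
  assumes x: "x \<longlonglongrightarrow> x0" "\<And>n. 0 \<le> x n" and x0: "0 \<le> x0"
  shows "(\<lambda>n. attractor_stdf L \<alpha> (x n)) \<longlonglongrightarrow> attractor_stdf L \<alpha> x0"
proof -
  have "(\<lambda>n. L (vec_powr (x n) (1 / \<alpha>))) \<longlonglongrightarrow> L (vec_powr x0 (1 / \<alpha>))"
    using index by (intro stdf_tendsto[OF L] vec_powr_tendsto x vec_powr_nonneg) auto
  then show ?thesis
    unfolding attractor_stdf_def using index stdf_nonneg[OF L vec_powr_nonneg]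
    by (intro tendsto_powr' tendsto_const) auto
qed

text \<open>
  With \<open>x = - ln u\<close> the inverse generators \<open>\<zeta>\<close> at \<open>u powr (1 / r)\<close> satisfy
  \<open>r * kappa_b \<psi> (1 / \<zeta>\<^sub>j) = x\<^sub>j\<close> exactly, and the power of the copula is \<open>exp (- r * kappa_b \<psi> (1 / L \<zeta>))\<close>.
  The expansion of the exponent carries over to the exponential. On the faces of the cube where a
  coordinate is 0, both copulas vanish.
\<close>

lemma BM_rate:
  assumes so: "second_order_rv (kappa_b \<psi>) \<alpha> B h" and par: "second_order_param \<alpha> h \<rho>" and rho: "\<rho> < 0"
  shows "\<exists>S. BM_second_order (archimax \<psi> L) (stdf_copula (attractor_stdf L \<alpha>)) (\<lambda>t. B (t powr (1 / \<alpha>))) S"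
    and "regularly_varying (\<lambda>t. B (t powr (1 / \<alpha>))) (\<rho> / \<alpha>)"
proof -
  note gen = psi dim index(1) rv
  define A where "A = attractor_stdf L \<alpha>"
  obtain a where a: "0 < a" "\<And>y. 0 < y \<Longrightarrow> y < a \<Longrightarrow> 0 < \<psi> y"
    using generator_pos_near_0[OF gen] unfolding eventually_at_right_field by blast
  \<comment> \<open>twice the reciprocal, so that \<open>1 / w\<close> stays strictly below \<open>a\<close> also at \<open>w = w0\<close>\<close>
  define w0 where "w0 = 2 / a"
  have w0: "0 < w0" using a by (simp add: w0_def)
  have inv: "0 < 1 / w" "1 / w < a" if "w0 \<le> w" for w
  proof -
    have "0 < w" using w0 that by linarith
    then show "0 < 1 / w" by simp
    have "2 \<le> a * w" using that a by (simp add: w0_def field_simps)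
    then show "1 / w < a" using \<open>0 < w\<close> by (simp add: field_simps)
  qed
  have kappa_pos: "0 < kappa_b \<psi> w" if "w0 \<le> w" for w
  proof -
    have "0 < kappa_p \<psi> w" using rv inv(1)[OF that] by (simp add: regularly_varying_def)
    then show ?thesis using a(2)[OF inv[OF that]] by (simp add: kappa_b_def kappa_p_def)
  qed
  have kappa_cont: "continuous_on {w0..} (kappa_b \<psi>)"
    unfolding kappa_b_def
    by (intro continuous_intros continuous_on_compose2[OF generator_continuous[OF gen]])
      (use inv a(2) w0 in \<open>auto simp: less_le\<close>)
  obtain \<gamma> where "second_order_tail (kappa_b \<psi>) B \<alpha> \<rho> \<gamma> w0"
    using second_order_tailI[OF so par rho index(1) w0 kappa_pos kappa_cont] by auto
  then interpret second_order_tail "kappa_b \<psi>" B \<alpha> \<rho> \<gamma> w0 .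
  show "regularly_varying (\<lambda>t. B (t powr (1 / \<alpha>))) (\<rho> / \<alpha>)" by (rule rate_regularly_varying)
  have kappa_0: "kappa_b \<psi> 0 = 0" by (simp add: kappa_b_def generator_at_0[OF gen])
  have mono: "kappa_b \<psi> (1 / y) \<le> kappa_b \<psi> (1 / z)" if "0 \<le> y" "y \<le> z" "z \<in> {z. 0 < \<psi> z}" for y z
    using generator_antimono[OF gen that(1,2)] that(3) by (simp add: kappa_b_def)
  have near: "\<forall>\<^sub>F y in at_right 0. y \<in> {z. 0 < \<psi> z}" using generator_pos_near_0[OF gen] by simp
  obtain K where K: "K \<noteq> 0" and lim: "\<And>t x x0 \<zeta>. filterlim t at_top sequentially \<Longrightarrow> (\<And>n. 0 < t n) \<Longrightarrow> x \<longlonglongrightarrow> x0 \<Longrightarrow>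
      (\<And>n. 0 \<le> x n) \<Longrightarrow> (\<And>n. 0 \<le> \<zeta> n) \<Longrightarrow> (\<And>n j. \<zeta> n $ j \<in> {z. 0 < \<psi> z}) \<Longrightarrow>
      (\<And>n j. t n * kappa_b \<psi> (1 / \<zeta> n $ j) = x n $ j) \<Longrightarrow>
      (\<lambda>n. (t n * kappa_b \<psi> (1 / L (\<zeta> n)) - A (x n)) / B (t n powr (1 / \<alpha>)))
        \<longlonglongrightarrow> K * second_order_profile L \<alpha> (- \<rho> / \<alpha>) x0"
    and lim0: "\<And>t x x0 \<zeta>. filterlim t at_top sequentially \<Longrightarrow> (\<And>n. 0 < t n) \<Longrightarrow> x \<longlonglongrightarrow> x0 \<Longrightarrow>
      (\<And>n. 0 \<le> x n) \<Longrightarrow> (\<And>n. 0 \<le> \<zeta> n) \<Longrightarrow> (\<And>n j. \<zeta> n $ j \<in> {z. 0 < \<psi> z}) \<Longrightarrow>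
      (\<And>n j. t n * kappa_b \<psi> (1 / \<zeta> n $ j) = x n $ j) \<Longrightarrow> (\<lambda>n. L (\<zeta> n)) \<longlonglongrightarrow> 0"
    unfolding A_def by (rule archimax_second_order[OF L smooth index(2) kappa_0 mono near]) blast+
  define neg_log where "neg_log u = (\<chi> j. - ln (u $ j))" for u :: "real ^ 'n"
  define S where "S u = (if \<forall>j. 0 < u $ j then - (exp (- A (neg_log u)) * (K * second_order_profile L \<alpha>
      (- \<rho> / \<alpha>) (neg_log u))) else 0)"
    for u
  define Q where "Q r u = (archimax \<psi> L (vec_powr u (1 / r)) powr r
      - stdf_copula A u) / B (r powr (1 / \<alpha>))" for r u
  have Q_eq: "Q = (\<lambda>r u. (archimax \<psi> L (vec_powr u (1 / r)) powr r - stdf_copula A u) / B (r powr (1 / \<alpha>)))"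
    by (intro ext) (rule Q_def)
  have uniform: "uniform_limit U Q S at_top"
    if U: "compact U" "\<And>u j. u \<in> U \<Longrightarrow> 0 < u $ j \<and> u $ j \<le> 1" for U
  proof (rule uniform_limit_compactI[OF U(1), of 1])
    fix t :: "nat \<Rightarrow> real" and u :: "nat \<Rightarrow> real ^ 'n" and u0
    assume t1: "\<And>n. 1 \<le> t n" and t: "filterlim t at_top sequentially"
      and uU: "\<And>n. u n \<in> U" "u0 \<in> U" and u: "u \<longlonglongrightarrow> u0"
    have tpos: "0 < t n" for n using t1[of n] by linarith
    have un: "0 < u n $ j" "u n $ j \<le> 1" "0 < u0 $ j" "u0 $ j \<le> 1" for n j using U(2) uU by auto
    have x: "(\<lambda>n. neg_log (u n)) \<longlonglongrightarrow> neg_log u0"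
      unfolding neg_log_def using un(3)
      by (intro tendsto_vec_lambda tendsto_minus tendsto_ln tendsto_vec_nth u)
          (simp add: less_imp_neq[THEN not_sym])
    have x_nonneg: "0 \<le> neg_log (u n)" "0 \<le> neg_log u0" for n
      using un by (auto simp: neg_log_def less_eq_vec_def)
    have "\<exists>z. 0 \<le> z \<and> (\<forall>j. \<psi> (z $ j) = vec_powr (u n) (1 / t n) $ j) \<and> archimax \<psi> L (vec_powr (u n)
        (1 / t n)) = \<psi> (L z)" for n
    proof -
      have "0 < vec_powr (u n) (1 / t n) $ j" "vec_powr (u n) (1 / t n) $ j \<le> 1" for j
        using un(1,2)[of n j] tpos[of n] by (auto simp: vec_powr_def powr_le1)
      then show ?thesis using archimax_interior[OF gen] by metis
    qed
    then obtain \<zeta> where z: "\<And>n. 0 \<le> \<zeta> n" "\<And>n j. \<psi> (\<zeta> n $ j) = vec_powr (u n) (1 / t n) $ j"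
      "\<And>n. archimax \<psi> L (vec_powr (u n) (1 / t n)) = \<psi> (L (\<zeta> n))" by metis
    have z_pos: "\<zeta> n $ j \<in> {z. 0 < \<psi> z}" for n j
      using un(1)[of n j] by (simp add: z(2)) (simp add: vec_powr_def)
    have z_eq: "t n * kappa_b \<psi> (1 / \<zeta> n $ j) = neg_log (u n) $ j" for n j
      using un(1)[of n j] tpos[of n] by (simp add: kappa_b_def z(2) vec_powr_def neg_log_def ln_powr)
    define b where "b n = B (t n powr (1 / \<alpha>))" for n
    define v where "v n = (t n * kappa_b \<psi> (1 / L (\<zeta> n)) - A (neg_log (u n))) / b n" for n
    have v: "v \<longlonglongrightarrow> K * second_order_profile L \<alpha> (- \<rho> / \<alpha>) (neg_log u0)"
      unfolding v_def b_def by (rule lim[OF t tpos x x_nonneg(1) z(1) z_pos z_eq])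
    have Lz: "(\<lambda>n. L (\<zeta> n)) \<longlonglongrightarrow> 0" by (rule lim0[OF t tpos x x_nonneg(1) z(1) z_pos z_eq])
    have b_pos: "0 < b n" for n using B_pos tpos[of n] by (simp add: b_def)
    have b_lim: "b \<longlonglongrightarrow> 0" unfolding b_def by (rule filterlim_compose[OF rate_tendsto_zero t])
    have "(\<lambda>n. exp (- A (neg_log (u n))) * ((exp (- (v n * b n)) - 1) / b n))
        \<longlonglongrightarrow> exp (- A (neg_log u0)) * (- 1 * (K * second_order_profile L \<alpha> (- \<rho> / \<alpha>) (neg_log u0)))"
      unfolding A_def
      by (intro tendsto_mult tendsto_exp tendsto_minus attractor_tendsto x x_nonneg
          tendsto_secant[where f = "\<lambda>y. exp (- y) - 1"] v b_lim)
        (use b_pos in \<open>auto intro!: derivative_eq_intros simp: less_imp_neq[THEN not_sym]\<close>)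
    moreover have "\<forall>\<^sub>F n in sequentially. exp (- A (neg_log (u n))) * ((exp (- (v n * b n)) - 1) / b n)
        = Q (t n) (u n)"
    proof -
      have "\<forall>\<^sub>F n in sequentially. L (\<zeta> n) < a" using order_tendstoD(2)[OF Lz a(1)] .
      then show ?thesis
      proof eventually_elim
        case (elim n)
        have "0 < \<psi> (L (\<zeta> n))"
          using a(2)[of "L (\<zeta> n)"] elim stdf_nonneg[OF L z(1)[of n]] generator_at_0[OF gen]
          by (cases "L (\<zeta> n) = 0") auto
        then have "archimax \<psi> L (vec_powr (u n) (1 / t n)) powr t n
            = exp (- (t n * kappa_b \<psi> (1 / L (\<zeta> n))))"
          by (simp add: z(3) powr_def kappa_b_def)
        also have "t n * kappa_b \<psi> (1 / L (\<zeta> n)) = A (neg_log (u n)) + v n * b n"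
          using b_pos[of n] by (simp add: v_def)
        finally have "archimax \<psi> L (vec_powr (u n) (1 / t n)) powr t n
            = exp (- A (neg_log (u n))) * exp (- (v n * b n))"
          by (simp add: exp_add[symmetric])
        moreover have "stdf_copula A (u n) = exp (- A (neg_log (u n)))"
          using un by (simp add: stdf_copula_def neg_log_def)
        ultimately show ?case by (simp add: Q_def b_def[symmetric] algebra_simps diff_divide_distrib)
      qed
    qed
    ultimately show "(\<lambda>n. Q (t n) (u n)) \<longlonglongrightarrow> S u0"
      by (rule Lim_transform_eventually[THEN tendsto_eq_rhs]) (use un(3) in \<open>simp add: S_def\<close>)
  qed
  have pointwise: "((\<lambda>r. Q r u) \<longlongrightarrow> S u) at_top" if u: "u \<in> {0..1}" for u
  proof (cases "\<forall>j. 0 < u $ j")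
    case True
    have "uniform_limit {u} Q S at_top"
      using True u by (intro uniform) (auto simp: less_eq_vec_def)
    then show ?thesis by (rule tendsto_uniform_limitI) simp
  next
    case False
    then obtain i where "\<not> 0 < u $ i" by blast
    moreover have "0 \<le> u $ i" using u by (simp add: less_eq_vec_def)
    ultimately have i: "u $ i = 0" by simp
    have "\<forall>\<^sub>F r in at_top. 0 = Q r u"
      using eventually_gt_at_top[of 0]
    proof eventually_elim
      case (elim r)
      have "vec_powr u (1 / r) \<in> {0..1}" "vec_powr u (1 / r) $ i = 0"
        using u i elim by (auto simp: vec_powr_def less_eq_vec_def powr_le1)
      then have "archimax \<psi> L (vec_powr u (1 / r)) = 0"
        by (rule archimax_zero[OF gen]) (rule stdf_ge_component[OF L])
      then show ?case using False by (auto simp: Q_def stdf_copula_def)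
    qed
    then show ?thesis using False by (auto simp: S_def intro: Lim_transform_eventually[OF tendsto_const])
  qed
  have strips: "uniform_limit {vec \<delta>..1} Q S at_top" if \<delta>: "0 < \<delta>" for \<delta>
    using \<delta> by (intro uniform) (auto simp: interval_cbox_cart[symmetric] less_eq_vec_def intro: less_le_trans)
  have "\<exists>u\<in>{0..1}. S u \<noteq> 0"
  proof
    define u where "u = (\<chi> j::'n. exp (- 1 :: real))"
    show "u \<in> {0..1}" by (simp add: u_def less_eq_vec_def)
    have "neg_log u = 1" by (simp add: neg_log_def u_def vec_eq_iff)
    then show "S u \<noteq> 0"
      using second_order_profile_one_pos[OF L index smooth dim, of "- \<rho> / \<alpha>"] K rho index
      by (auto simp: S_def u_def divide_neg_pos)
  qed
  then have "BM_second_order (archimax \<psi> L) (stdf_copula A) (\<lambda>t. B (t powr (1 / \<alpha>))) S"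
    unfolding BM_second_order_def
    using B_pos rate_tendsto_zero pointwise[unfolded Q_def] strips[unfolded Q_eq] by auto
  then show "\<exists>S. BM_second_order (archimax \<psi> L) (stdf_copula (attractor_stdf L \<alpha>)) (\<lambda>t. B (t powr
      (1 / \<alpha>))) S"
    unfolding A_def by blast
qed

end

theorem proposition3p1:
  fixes L0 :: "real ^ 'n \<Rightarrow> real" and \<psi> :: "real \<Rightarrow> real" and \<alpha> :: real
  assumes "CARD('n) \<ge> 2"
    and "stable_tail_dependence L0"
    and "archimedean_generator CARD('n) \<psi>"
    and "0 < \<alpha>" "\<alpha> \<le> 1"
    and "regularly_varying (kappa_p \<psi>) (- \<alpha>)"
    and "has_continuous_partials L0"
  shows "(\<forall>B h \<rho>. second_order_rv (kappa_p \<psi>) \<alpha> B h \<and> second_order_param \<alpha> h \<rho> \<and> \<rho> < 0 \<longrightarrow>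
            (\<exists>S. POT_second_order (archimax \<psi> L0) (attractor_stdf L0 \<alpha>)
                   (\<lambda>t. B (t powr (1 / \<alpha>))) S) \<and>
            regularly_varying (\<lambda>t. B (t powr (1 / \<alpha>))) (\<rho> / \<alpha>))
       \<and> (\<forall>B h \<rho>. second_order_rv (kappa_b \<psi>) \<alpha> B h \<and> second_order_param \<alpha> h \<rho> \<and> \<rho> < 0 \<longrightarrow>
            (\<exists>S. BM_second_order (archimax \<psi> L0) (stdf_copula (attractor_stdf L0 \<alpha>))
                   (\<lambda>t. B (t powr (1 / \<alpha>))) S) \<and>
            regularly_varying (\<lambda>t. B (t powr (1 / \<alpha>))) (\<rho> / \<alpha>))"
  using POT_rate[OF assms] BM_rate[OF assms] by blast

end
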